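(* Consider the integral form of the stratified vector radiative transfer problem with Fresnel interface for the unknowns $T(z)$ (temperature) and $\mathbf I'=[I_l,I_r]^T(z,\mu,\nu)$, and the iterations on the sources $(T^m,I_l^m,I_r^m)\mapsto(T^{m+1},I_l^{m+1},I_r^{m+1})$, both defined in the context. All inequalities below are pointwise and componentwise. (1) If the solution $(T^*,I_l^*,I_r^* )$ of the problem exists, then it can be reached numerically from above or below by the iterations on the sources, and these are monotone increasing in $m$ if initiated with $T^0=0$, $I_l^0=I_r^0=0$, and monotone decreasing in $m$ if initiated with $T^0$ and $I_l^0,I_r^0$ such that $T^1\le T^0$, $I_l^1\le I_l^0$ and $I_r^1\le I_r^0$. (2) Furthermore, if an initial guess for a decreasing sequence can be found, i.e. nonnegative $T^0,I_l^0,I_r^0$ such that $T^1\le T^0$, $I_l^1\le I_l^0$, $I_r^1\le I_r^0$, then convergence of the iterations is implied and a solution $(T,I_l,I_r)$ of the problem exists.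
   Context: **Data.** $0<Y<Z$. Altitude $z\in(0,Z)$, direction cosine $\mu\in[-1,1]\setminus\{0\}$, frequency $\nu\in(0,\infty)$. The refractive index $n_z=n(z)>0$ is a smooth function $n^-(z)$ on $(0,Y)$ and a smooth function $n^+(z)$ on $(Y,Z)$, with one-sided limits $n_-$ at $Y^-$ and $n_+$ at $Y^+$. Put $n_\pm:=n_+/n_-$ and $n_\mp:=n_-/n_+$. The absorption is $\kappa=\kappa(z,\nu)>0$, the scattering coefficient is $a_s=a_s(z,\nu)\in[0,1)$, $\kappa_s=\kappa a_s$, $\kappa_a=\kappa(1-a_s)$, and $\beta\in[0,1]$. The rescaled Planck function is $B_\nu(T)=\nu^3(e^{\nu/T}-1)^{-1}$ for $T>0$, $B_\nu(0)=0$, and $\tilde B_\nu(T)=B_\nu(T)/n(z)^2$. Intensities are also divided by $n^2$: $I_l,I_r$ denote the two orthogonal polarization components divided by $n^2$. Boundary values $\mathbf I'(0,\mu)$ for $\mu>0$ and $\mathbf I'(Z,\mu)$ for $\mu<0$ are prescribed and nonnegative. **Source.** Given $I_l,I_r,T$, let $\mathbf S'=[S_1',S_2']^T(z,\mu)$ (for each $\nu$) with $$S'_1=\tfrac{3\beta\kappa_s}{8}\int_{-1}^1\Big([2(1-\mu'^2)(1-\mu^2)+\mu'^2\mu^2]I_l(z,\mu')+\mu^2I_r(z,\mu')\Big)d\mu'+\tfrac{(1-\beta)\kappa_s}{4}\int_{-1}^1(I_l+I_r)(z,\mu')\,d\mu'+\tfrac{\kappa_a}{2}\tilde B_\nu(T(z)),$$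 $$S'_2=\tfrac{3\beta\kappa_s}{8}\int_{-1}^1\big(\mu'^2I_l+I_r\big)(z,\mu')\,d\mu'+\tfrac{(1-\beta)\kappa_s}{4}\int_{-1}^1(I_l+I_r)(z,\mu')\,d\mu'+\tfrac{\kappa_a}{2}\tilde B_\nu(T(z)).$$ **Characteristics.** For a reference point $(z,\mu)$ let $\eta(\tfrac{n_z}{n_y})=\sqrt{1-(\tfrac{n_z}{n_y})^2(1-\mu^2)}$ and, for $z'\le z''$, $$\phi(z',z'')=\exp\Big\{-\int_{z'}^{z''}\frac{\kappa(y)}{\eta(n_z/n_y)}\,dy\Big\},$$ $\mathbb I(y)=\mathbf I'(y,\mathrm{sign}(\mu)\,\eta(\tfrac{n_z}{n_y}))$, $\mathbb I(y,-\mu)=\mathbf I'(y,-\mathrm{sign}(\mu)\,\eta(\tfrac{n_z}{n_y}))$, $\mathbb S'(y)=\mathbf S'(y,\eta(\tfrac{n_z}{n_y}))/\eta(\tfrac{n_z}{n_y})$. Let $$\eta_\pm(\tfrac{n_z}{n_y})=\Big(1-n_\pm^2\big(1-\eta(\tfrac{n_z}{n_y})^2\big)\Big)^{1/2},$$ and let $\phi_\pm$ be defined as $\phi$ with $\eta_\pm$ in place of $\eta$, $\mathbb I_\pm(y)=\mathbf I'(y,\mathrm{sign}(\mu)\,\eta_\pm(\tfrac{n_z}{n_y}))$, $\mathbb S'_\pm(y)=\mathbf S'(y,\eta_\pm(\tfrac{n_z}{n_y}))/\eta_\pm(\tfrac{n_z}{n_y})$; $\eta_\mp,\phi_\mp,\mathbb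 I_\mp,\mathbb S'_\mp$ are defined likewise with $n_\mp$ in place of $n_\pm$. These quantities are used only where the expressions under the square roots are positive; terms for which they are not are omitted (set to zero, including any $\phi$-type factor whose integrand is not defined on part of its interval). **Fresnel matrices.** For $\mu\in(0,1)$, put $\eta(n,\mu)=\sqrt{1-n^2(1-\mu^2)}$ and, for $n\ge1$, $\mu_c(n)=\sqrt{1-1/n^2}$. If $n\le1$, or if $n\ge1$ and $\mu>\mu_c(n)$, $$\mathbf X'(n,\mu)=\mathrm{diag}\left(\Big[\tfrac{\mu-n\eta(n,\mu)}{\mu+n\eta(n,\mu)}\Big]^2,\Big[\tfrac{n\mu-\eta(n,\mu)}{n\mu+\eta(n,\mu)}\Big]^2\right),\quad \mathbf Y'(n,\mu)=\mathrm{diag}\left(\tfrac{4n\mu\,\eta(n,\mu)}{[\mu+n\eta(n,\mu)]^2},\tfrac{4n\mu\,\eta(n,\mu)}{[n\mu+\eta(n,\mu)]^2}\right);$$ if $n\ge1$ and $\mu<\mu_c(n)$ then $\mathbf X'(n,\mu)$ is the identity and $\mathbf Y'(n,\mu)=0$. Write $\mathbf X'_\pm=\mathbf X'(n_\pm,|\mu|)$, $\mathbf X'_\mp=\mathbf X'(n_\mp,|\mu|)$, and similarly $\mathbf Y'_\pm,\mathbf Y'_\mp$. **Jump.** For given $\mathbf S'$, define $\Delta(z,\mu)$ for $\mu>0$ by $$\Delta=\mathbf X'_\pm\Big[\phi(Y,Z)\mathbb I(Z,-\mu)+\int_Y^Z\phi(Y,z')\mathbb S'(z')dz'\Big]+\mathbf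 Y'_\pm\Big[\phi_\pm(0,Y)\mathbb I_\pm(0)+\int_0^Y\phi_\pm(z',Y)\mathbb S'_\pm(z')dz'\Big]-\phi(0,Y)\mathbb I(0)-\int_0^Y\phi(z',Y)\mathbb S'(z')dz',$$ and for $\mu<0$ by $$\Delta=\phi(Y,Z)\mathbb I(Z)+\int_Y^Z\phi(Y,z')\mathbb S'(z')dz'-\mathbf X'_\mp\Big[\phi(0,Y)\mathbb I(0,-\mu)+\int_0^Y\phi(z',Y)\mathbb S'(z')dz'\Big]-\mathbf Y'_\mp\Big[\phi_\mp(Y,Z)\mathbb I_\mp(Z)+\int_Y^Z\phi_\mp(Y,z')\mathbb S'_\mp(z')dz'\Big].$$ All values of $\mathbf I'$ occurring here are the prescribed boundary values at $0$ (upward directions) and at $Z$ (downward directions). **Iterations on the sources.** Given $(T^m,I_l^m,I_r^m)$, let $\mathbf S'^m$ be the source and $\Delta^m$ the jump computed from it. Then $$\mathbf I'^{\,m+1}(z,\mu)=\mathbf 1_{\mu>0}\Big[\phi(0,z)\mathbb I(0)+\int_0^z\phi(z',z)\mathbb S'^m(z')dz'\Big]+\mathbf 1_{\mu<0}\Big[\phi(z,Z)\mathbb I(Z)+\int_z^Z\phi(z,z')\mathbb S'^m(z')dz'\Big]$$ $$\qquad+\big[\mathbf 1_{z>Y}\mathbf 1_{\mu>0}\phi(Y,z)-\mathbf 1_{z<Y}\mathbf 1_{\mu<0}\phi(z,Y)\big]\Delta^m(z,\mu),$$ and $T^{m+1}(z)\ge0$ is determined for each $z\in(0,Z)$ by $$\int_0^\infty\kappa_a\tilde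 B_\nu(T^{m+1}(z))\,d\nu=\int_0^\infty\kappa_a\,\tfrac12\int_{-1}^1\big(I_l^{m+1}+I_r^{m+1}\big)(z,\mu)\,d\mu\,d\nu .$$ **The problem and its solution.** A solution of the problem (the vector radiative refractive transfer system with Fresnel conditions at $z=Y$, coupled to the temperature equation, in integral form) is a nonnegative triple $(T,I_l,I_r)$ that is a fixed point of this iteration map. "Reached from below (above)" means obtained as the limit of an increasing (decreasing) sequence of iterates.
   Formalization: In (1), convergence to the given solution is proved when it is the only solution; in general the iterates from zero reach the least solution and decreasing iterates reach some solution. Without uniqueness the claim fails (n=1, a_s=0, κ=1/z²+1/(Z−z)²: every constant T solves). *)

theory Defs
  imports "HOL-Analysis.Analysis"
begin

record medium =
  z_int   :: real                                  (* Y, the height of the interface *)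
  z_top   :: real                                  (* Z *)
  refr    :: "real \<Rightarrow> real"                        (* n(z); n(Y) is arbitrary, it only affects altitude z = Y *)
  n_below :: real                                  (* limit of n at Y from below *)
  n_above :: real                                  (* limit of n at Y from above *)
  kappa   :: "real \<Rightarrow> real \<Rightarrow> real"                (* arguments z, nu *)
  albedo  :: "real \<Rightarrow> real \<Rightarrow> real"                (* a_s(z, nu) *)
  ray     :: real                                  (* beta *)
  inflow0 :: "real \<Rightarrow> real \<Rightarrow> real^2"              (* I'(0, mu) at frequency nu, for mu > 0 *)
  inflowZ :: "real \<Rightarrow> real \<Rightarrow> real^2"              (* I'(Z, mu) at frequency nu, for mu < 0 *)

text \<open>A state is \<open>(T, I')\<close>, where \<open>I' z \<mu> \<nu>\<close> is the vector \<open>[I_l, I_r]\<close> (intensities divided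
  by \<open>n\<^sup>2\<close>). The order on \<open>real^2\<close> is componentwise. Only the values for \<open>z\<close> in \<open>(0,Z)\<close>,
  \<open>\<mu>\<close> in \<open>[-1,1] - {0}\<close> and \<open>\<nu> > 0\<close> matter.\<close>

type_synonym state = "(real \<Rightarrow> real) \<times> (real \<Rightarrow> real \<Rightarrow> real \<Rightarrow> real^2)"

definition alts :: "medium \<Rightarrow> real set" where
  "alts D = {0<..<z_top D}"

definition dirs :: "real set" where
  "dirs = {-1..1} - {0}"

definition freqs :: "real set" where
  "freqs = {0<..}"

definition smooth_on :: "real set \<Rightarrow> (real \<Rightarrow> real) \<Rightarrow> bool" where
  "smooth_on S f \<longleftrightarrow> (\<forall>k. \<forall>x\<in>S. ((deriv ^^ k) f) field_differentiable (at x))"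

definition medium_ok :: "medium \<Rightarrow> bool" where
  "medium_ok D \<longleftrightarrow>
     0 < z_int D \<and> z_int D < z_top D \<and>
     (\<forall>z\<in>{0..z_top D}. 0 < refr D z) \<and>
     smooth_on {0<..<z_int D} (refr D) \<and>
     smooth_on {z_int D<..<z_top D} (refr D) \<and>
     (refr D \<longlongrightarrow> n_below D) (at_left (z_int D)) \<and> 0 < n_below D \<and>
     (refr D \<longlongrightarrow> n_above D) (at_right (z_int D)) \<and> 0 < n_above D \<and>
     (\<forall>z\<in>alts D. \<forall>\<nu>\<in>freqs. 0 < kappa D z \<nu>) \<and>
     (\<lambda>(z, \<nu>). kappa D z \<nu>) \<in> borel_measurable (restrict_space borel (alts D \<times> freqs)) \<and>
     (\<forall>z\<in>alts D. \<forall>\<nu>\<in>freqs. 0 \<le> albedo D z \<nu> \<and> albedo D z \<nu> < 1) \<and>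
     (\<lambda>(z, \<nu>). albedo D z \<nu>) \<in> borel_measurable (restrict_space borel (alts D \<times> freqs)) \<and>
     0 \<le> ray D \<and> ray D \<le> 1 \<and>
     (\<forall>\<mu>\<in>{0<..1}. \<forall>\<nu>\<in>freqs. 0 \<le> inflow0 D \<mu> \<nu>) \<and>
     (\<lambda>(\<mu>, \<nu>). inflow0 D \<mu> \<nu>) \<in> borel_measurable (restrict_space borel ({0<..1} \<times> freqs)) \<and>
     (\<forall>\<mu>\<in>{-1..<0}. \<forall>\<nu>\<in>freqs. 0 \<le> inflowZ D \<mu> \<nu>) \<and>
     (\<lambda>(\<mu>, \<nu>). inflowZ D \<mu> \<nu>) \<in> borel_measurable (restrict_space borel ({-1..<0} \<times> freqs))"

definition kappa_s :: "medium \<Rightarrow> real \<Rightarrow> real \<Rightarrow> real" where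
  "kappa_s D z \<nu> = kappa D z \<nu> * albedo D z \<nu>"

definition kappa_a :: "medium \<Rightarrow> real \<Rightarrow> real \<Rightarrow> real" where
  "kappa_a D z \<nu> = kappa D z \<nu> * (1 - albedo D z \<nu>)"

definition planck :: "real \<Rightarrow> real \<Rightarrow> real" where
  "planck \<nu> t = (if t = 0 then 0 else \<nu> ^ 3 / (exp (\<nu> / t) - 1))"

definition planck_n :: "medium \<Rightarrow> real \<Rightarrow> real \<Rightarrow> real \<Rightarrow> real" where
  "planck_n D z \<nu> t = planck \<nu> t / (refr D z)\<^sup>2"

definition source :: "medium \<Rightarrow> state \<Rightarrow> real \<Rightarrow> real \<Rightarrow> real \<Rightarrow> real^2" where
  "source D X z \<mu> \<nu> =
    (let T = fst X; Il = (\<lambda>\<mu>'. snd X z \<mu>' \<nu> $ 1); Ir = (\<lambda>\<mu>'. snd X z \<mu>' \<nu> $ 2);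
         \<beta> = ray D; ks = kappa_s D z \<nu>; ka = kappa_a D z \<nu>
     in vector
      [3 * \<beta> * ks / 8 * (LBINT \<mu>':{-1..1}.
            (2 * (1 - \<mu>'\<^sup>2) * (1 - \<mu>\<^sup>2) + \<mu>'\<^sup>2 * \<mu>\<^sup>2) * Il \<mu>' + \<mu>\<^sup>2 * Ir \<mu>')
         + (1 - \<beta>) * ks / 4 * (LBINT \<mu>':{-1..1}. Il \<mu>' + Ir \<mu>')
         + ka / 2 * planck_n D z \<nu> (T z),
       3 * \<beta> * ks / 8 * (LBINT \<mu>':{-1..1}. \<mu>'\<^sup>2 * Il \<mu>' + Ir \<mu>')
         + (1 - \<beta>) * ks / 4 * (LBINT \<mu>':{-1..1}. Il \<mu>' + Ir \<mu>')
         + ka / 2 * planck_n D z \<nu> (T z)])"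

text \<open>Direction cosines at altitude \<open>y\<close> on the characteristics attached to a reference point
  \<open>(z, \<mu>)\<close>. The value 0 encodes "undefined", i.e. an expression under a square root that is not
  positive. \<open>eta_jump D r\<close> with \<open>r = n_above / n_below\<close> (resp. the inverse ratio) is \<open>\<eta>\<close> with
  subscript plus-minus (resp. minus-plus); it needs both of its nested roots.\<close>

definition pos_sqrt :: "real \<Rightarrow> real" where
  "pos_sqrt x = (if 0 < x then sqrt x else 0)"

definition eta :: "medium \<Rightarrow> real \<Rightarrow> real \<Rightarrow> real \<Rightarrow> real" where
  "eta D z \<mu> y = pos_sqrt (1 - (refr D z / refr D y)\<^sup>2 * (1 - \<mu>\<^sup>2))"

definition eta_jump :: "medium \<Rightarrow> real \<Rightarrow> real \<Rightarrow> real \<Rightarrow> real \<Rightarrow> real" where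
  "eta_jump D r z \<mu> y =
     (if 0 < eta D z \<mu> y then pos_sqrt (1 - r\<^sup>2 * (1 - (eta D z \<mu> y)\<^sup>2)) else 0)"

text \<open>In what follows \<open>c\<close> is such a cosine, as a function of the altitude. The transmission factor
  \<open>\<phi>(z', z'')\<close> is 0 if \<open>c\<close> is undefined somewhere on the interval, and also if the nonnegative
  integrand is not integrable: its integral is then infinite and the exponential vanishes.\<close>

definition transm :: "medium \<Rightarrow> (real \<Rightarrow> real) \<Rightarrow> real \<Rightarrow> real \<Rightarrow> real \<Rightarrow> real" where
  "transm D c \<nu> z' z'' =
     (if (\<forall>y\<in>{z'<..<z''} - {z_int D}. 0 < c y) \<and>
         set_integrable lborel {z'<..<z''} (\<lambda>y. kappa D y \<nu> / c y)
      then exp (- (LBINT y:{z'<..<z''}. kappa D y \<nu> / c y)) else 0)"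

definition src_along :: "medium \<Rightarrow> state \<Rightarrow> (real \<Rightarrow> real) \<Rightarrow> real \<Rightarrow> real \<Rightarrow> real^2" where
  "src_along D X c \<nu> y = (if 0 < c y then (1 / c y) *\<^sub>R source D X y (c y) \<nu> else 0)"

text \<open>Boundary values only enter as upward intensities at 0 and downward intensities at \<open>Z\<close>: for
  \<open>\<mu> > 0\<close> the direction is \<open>sign \<mu> * c\<close> at 0 and \<open>-sign \<mu> * c\<close> at \<open>Z\<close>, and conversely for
  \<open>\<mu> < 0\<close>.\<close>

definition inflow0_along :: "medium \<Rightarrow> (real \<Rightarrow> real) \<Rightarrow> real \<Rightarrow> real^2" where
  "inflow0_along D c \<nu> = (if 0 < c 0 then inflow0 D (c 0) \<nu> else 0)"

definition inflowZ_along :: "medium \<Rightarrow> (real \<Rightarrow> real) \<Rightarrow> real \<Rightarrow> real^2" where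
  "inflowZ_along D c \<nu> = (if 0 < c (z_top D) then inflowZ D (- c (z_top D)) \<nu> else 0)"

definition beam_up :: "medium \<Rightarrow> state \<Rightarrow> (real \<Rightarrow> real) \<Rightarrow> real \<Rightarrow> real \<Rightarrow> real^2" where
  "beam_up D X c \<nu> z = transm D c \<nu> 0 z *\<^sub>R inflow0_along D c \<nu>
     + (LBINT z':{0<..<z}. transm D c \<nu> z' z *\<^sub>R src_along D X c \<nu> z')"

definition beam_down :: "medium \<Rightarrow> state \<Rightarrow> (real \<Rightarrow> real) \<Rightarrow> real \<Rightarrow> real \<Rightarrow> real^2" where
  "beam_down D X c \<nu> z = transm D c \<nu> z (z_top D) *\<^sub>R inflowZ_along D c \<nu>
     + (LBINT z':{z<..<z_top D}. transm D c \<nu> z z' *\<^sub>R src_along D X c \<nu> z')"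

definition beam_up_conv :: "medium \<Rightarrow> state \<Rightarrow> (real \<Rightarrow> real) \<Rightarrow> real \<Rightarrow> real \<Rightarrow> bool" where
  "beam_up_conv D X c \<nu> z \<longleftrightarrow>
     set_integrable lborel {0<..<z} (\<lambda>z'. transm D c \<nu> z' z *\<^sub>R src_along D X c \<nu> z')"

definition beam_down_conv :: "medium \<Rightarrow> state \<Rightarrow> (real \<Rightarrow> real) \<Rightarrow> real \<Rightarrow> real \<Rightarrow> bool" where
  "beam_down_conv D X c \<nu> z \<longleftrightarrow>
     set_integrable lborel {z<..<z_top D} (\<lambda>z'. transm D c \<nu> z z' *\<^sub>R src_along D X c \<nu> z')"

definition diag2 :: "real \<Rightarrow> real \<Rightarrow> real^2^2" where
  "diag2 a b = vector [vector [a, 0], vector [0, b]]"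

definition eta_F :: "real \<Rightarrow> real \<Rightarrow> real" where
  "eta_F n \<mu> = sqrt (1 - n\<^sup>2 * (1 - \<mu>\<^sup>2))"

definition mu_crit :: "real \<Rightarrow> real" where
  "mu_crit n = sqrt (1 - 1 / n\<^sup>2)"

text \<open>At \<open>\<mu> = mu_crit n\<close> both branches of the Fresnel matrices agree, since \<open>eta_F n \<mu> = 0\<close>.\<close>

definition fresnel_X :: "real \<Rightarrow> real \<Rightarrow> real^2^2" where
  "fresnel_X n \<mu> =
     (if n \<le> 1 \<or> mu_crit n < \<mu>
      then diag2 (((\<mu> - n * eta_F n \<mu>) / (\<mu> + n * eta_F n \<mu>))\<^sup>2)
                 (((n * \<mu> - eta_F n \<mu>) / (n * \<mu> + eta_F n \<mu>))\<^sup>2)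
      else mat 1)"

definition fresnel_Y :: "real \<Rightarrow> real \<Rightarrow> real^2^2" where
  "fresnel_Y n \<mu> =
     (if n \<le> 1 \<or> mu_crit n < \<mu>
      then diag2 (4 * n * \<mu> * eta_F n \<mu> / (\<mu> + n * eta_F n \<mu>)\<^sup>2)
                 (4 * n * \<mu> * eta_F n \<mu> / (n * \<mu> + eta_F n \<mu>)\<^sup>2)
      else 0)"

definition ratio_pm :: "medium \<Rightarrow> real" where
  "ratio_pm D = n_above D / n_below D"

definition ratio_mp :: "medium \<Rightarrow> real" where
  "ratio_mp D = n_below D / n_above D"

definition jump :: "medium \<Rightarrow> state \<Rightarrow> real \<Rightarrow> real \<Rightarrow> real \<Rightarrow> real^2" where
  "jump D X z \<mu> \<nu> =
    (let Y = z_int D; c = eta D z \<mu>;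
         cpm = eta_jump D (ratio_pm D) z \<mu>; cmp = eta_jump D (ratio_mp D) z \<mu>
     in if 0 < \<mu> then
          fresnel_X (ratio_pm D) \<bar>\<mu>\<bar> *v beam_down D X c \<nu> Y
          + fresnel_Y (ratio_pm D) \<bar>\<mu>\<bar> *v beam_up D X cpm \<nu> Y
          - beam_up D X c \<nu> Y
        else
          beam_down D X c \<nu> Y
          - fresnel_X (ratio_mp D) \<bar>\<mu>\<bar> *v beam_up D X c \<nu> Y
          - fresnel_Y (ratio_mp D) \<bar>\<mu>\<bar> *v beam_down D X cmp \<nu> Y)"

definition next_I :: "medium \<Rightarrow> state \<Rightarrow> real \<Rightarrow> real \<Rightarrow> real \<Rightarrow> real^2" where
  "next_I D X z \<mu> \<nu> =
    (let Y = z_int D; c = eta D z \<mu>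
     in (if 0 < \<mu> then beam_up D X c \<nu> z else 0)
        + (if \<mu> < 0 then beam_down D X c \<nu> z else 0)
        + ((if Y < z \<and> 0 < \<mu> then transm D c \<nu> Y z else 0)
           - (if z < Y \<and> \<mu> < 0 then transm D c \<nu> z Y else 0)) *\<^sub>R jump D X z \<mu> \<nu>)"

definition absorbed :: "medium \<Rightarrow> (real \<Rightarrow> real \<Rightarrow> real \<Rightarrow> real^2) \<Rightarrow> real \<Rightarrow> real \<Rightarrow> real" where
  "absorbed D I z \<nu> =
     kappa_a D z \<nu> * (1 / 2 * (LBINT \<mu>:{-1..1}. I z \<mu> \<nu> $ 1 + I z \<mu> \<nu> $ 2))"

definition emitted :: "medium \<Rightarrow> real \<Rightarrow> real \<Rightarrow> real \<Rightarrow> real" where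
  "emitted D t z \<nu> = kappa_a D z \<nu> * planck_n D z \<nu> t"

definition is_temp :: "medium \<Rightarrow> (real \<Rightarrow> real \<Rightarrow> real \<Rightarrow> real^2) \<Rightarrow> real \<Rightarrow> real \<Rightarrow> bool" where
  "is_temp D I z t \<longleftrightarrow> 0 \<le> t \<and> set_integrable lborel freqs (emitted D t z) \<and>
     (LBINT \<nu>:freqs. emitted D t z \<nu>) = (LBINT \<nu>:freqs. absorbed D I z \<nu>)"

definition next_T :: "medium \<Rightarrow> state \<Rightarrow> real \<Rightarrow> real" where
  "next_T D X z = (THE t. is_temp D (next_I D X) z t)"

definition iter :: "medium \<Rightarrow> state \<Rightarrow> state" where
  "iter D X = (next_T D X, next_I D X)"

text \<open>All integrals in the iteration map converge at \<open>X\<close> and the new temperature is determined. As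
  Lebesgue integrals of non-integrable functions are 0 by convention, this has to be explicit.\<close>

definition iter_defined :: "medium \<Rightarrow> state \<Rightarrow> bool" where
  "iter_defined D X \<longleftrightarrow>
     (\<forall>z\<in>alts D. \<forall>\<nu>\<in>freqs. set_integrable lborel {-1..1} (\<lambda>\<mu>. snd X z \<mu> \<nu>)) \<and>
     (\<forall>z\<in>alts D. \<forall>\<mu>\<in>dirs. \<forall>\<nu>\<in>freqs.
        let Y = z_int D; c = eta D z \<mu>;
            cpm = eta_jump D (ratio_pm D) z \<mu>; cmp = eta_jump D (ratio_mp D) z \<mu>
        in (0 < \<mu> \<longrightarrow> beam_up_conv D X c \<nu> z) \<and>
           (\<mu> < 0 \<longrightarrow> beam_down_conv D X c \<nu> z) \<and>
           (Y < z \<and> 0 < \<mu> \<longrightarrow> beam_down_conv D X c \<nu> Y \<and> beam_up_conv D X cpm \<nu> Y \<and>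
                              beam_up_conv D X c \<nu> Y) \<and>
           (z < Y \<and> \<mu> < 0 \<longrightarrow> beam_down_conv D X c \<nu> Y \<and> beam_up_conv D X c \<nu> Y \<and>
                              beam_down_conv D X cmp \<nu> Y)) \<and>
     (\<forall>z\<in>alts D.
        (\<forall>\<nu>\<in>freqs. set_integrable lborel {-1..1} (\<lambda>\<mu>. next_I D X z \<mu> \<nu>)) \<and>
        set_integrable lborel freqs (absorbed D (next_I D X) z) \<and>
        (\<exists>!t. is_temp D (next_I D X) z t))"

definition measurable_state :: "medium \<Rightarrow> state \<Rightarrow> bool" where
  "measurable_state D X \<longleftrightarrow>
     fst X \<in> borel_measurable (restrict_space borel (alts D)) \<and>
     (\<lambda>(z, \<mu>, \<nu>). snd X z \<mu> \<nu>) \<in> borel_measurable (restrict_space borel (alts D \<times> dirs \<times> freqs))"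

definition state_le :: "medium \<Rightarrow> state \<Rightarrow> state \<Rightarrow> bool" where
  "state_le D X X' \<longleftrightarrow>
     (\<forall>z\<in>alts D. fst X z \<le> fst X' z) \<and>
     (\<forall>z\<in>alts D. \<forall>\<mu>\<in>dirs. \<forall>\<nu>\<in>freqs. snd X z \<mu> \<nu> \<le> snd X' z \<mu> \<nu>)"

definition state_eq :: "medium \<Rightarrow> state \<Rightarrow> state \<Rightarrow> bool" where
  "state_eq D X X' \<longleftrightarrow>
     (\<forall>z\<in>alts D. fst X z = fst X' z) \<and>
     (\<forall>z\<in>alts D. \<forall>\<mu>\<in>dirs. \<forall>\<nu>\<in>freqs. snd X z \<mu> \<nu> = snd X' z \<mu> \<nu>)"

definition state_lim :: "medium \<Rightarrow> (nat \<Rightarrow> state) \<Rightarrow> state \<Rightarrow> bool" where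
  "state_lim D Xs X \<longleftrightarrow>
     (\<forall>z\<in>alts D. (\<lambda>m. fst (Xs m) z) \<longlonglongrightarrow> fst X z) \<and>
     (\<forall>z\<in>alts D. \<forall>\<mu>\<in>dirs. \<forall>\<nu>\<in>freqs. (\<lambda>m. snd (Xs m) z \<mu> \<nu>) \<longlonglongrightarrow> snd X z \<mu> \<nu>)"

definition zero_state :: state where
  "zero_state = ((\<lambda>z. 0), (\<lambda>z \<mu> \<nu>. 0))"

definition admissible :: "medium \<Rightarrow> state \<Rightarrow> bool" where
  "admissible D X \<longleftrightarrow> state_le D zero_state X \<and> measurable_state D X \<and> iter_defined D X"

definition solution :: "medium \<Rightarrow> state \<Rightarrow> bool" where
  "solution D X \<longleftrightarrow> admissible D X \<and> state_eq D (iter D X) X"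

definition iterates :: "medium \<Rightarrow> state \<Rightarrow> nat \<Rightarrow> state" where
  "iterates D X0 m = (iter D ^^ m) X0"

definition decreasing_start :: "medium \<Rightarrow> state \<Rightarrow> bool" where
  "decreasing_start D X0 \<longleftrightarrow> admissible D X0 \<and> state_le D (iter D X0) X0"

end

theory Submission
  imports Defs
begin

text \<open>
  The theorem is an instance of monotone iteration: the iteration map is order preserving and
  continuous under dominated pointwise convergence, so that iterates which form a bounded monotone
  sequence converge to a fixed point. Four facts carry this.

  \<^item> Monotonicity. The source is a positive functional of the state: its angular integrals have
    nonnegative kernels and the Planck function increases with temperature. In the update of the
    intensities, only the term with the jump contains negative contributions. They cancel: the
    transmission factor is multiplicative along a characteristic (\<open>transm_split\<close>), so a beam past
    the interface contains exactly the attenuated incoming beam which the jump subtracts. What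
    remains has nonnegative coefficients (\<open>next_I_positive_form\<close>), the Fresnel matrices being nonnegative.

  \<^item> Temperature. Total emission is continuous and strictly increasing in the temperature where it is
    finite. Hence less absorbed energy gives a unique smaller temperature (\<open>temperature_exists\<close>,
    \<open>temperature_unique\<close>), and convergence of the absorbed energies gives convergence of the
    temperatures (\<open>next_T_tendsto\<close>).

  \<^item> Domination. None of the integrals has to converge a priori. If the iteration is defined at
    a state \<open>W\<close>, every integrand built from a measurable state between 0 and \<open>W\<close> lies between
    0 and that built from \<open>W\<close>. So the iteration is defined there too, its values are below those
    at \<open>W\<close> (locale \<open>dominated_iter\<close>), and dominated convergence gives continuity
    (\<open>iter_tendsto\<close>). The role of \<open>W\<close> is played by the given solution for iterates started at
    zero, and by the initial guess for decreasing iterates.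

  \<^item> Measurability. Iterates have to be measurable jointly in altitude, direction and
    frequency. The two points that are not routine are the positivity condition in the transmission
    factor, which ranges over uncountably many altitudes (\<open>pred_eta_jump_pos\<close>), and the temperature,
    which is defined implicitly (\<open>next_T_le_iff\<close>).
\<close>

section \<open>Nonnegative integrals of vector-valued functions\<close>

lemma norm_mono_nonneg:
  fixes x y :: "'a::ordered_euclidean_space"
  assumes "0 \<le> x" "x \<le> y"
  shows "norm x \<le> norm y"
proof (rule norm_le_componentwise)
  fix b :: 'a assume b: "b \<in> Basis"
  then have "0 \<le> x \<bullet> b" "x \<bullet> b \<le> y \<bullet> b"
    using assms by (auto simp: eucl_le[where 'a='a])
  then show "\<bar>x \<bullet> b\<bar> \<le> \<bar>y \<bullet> b\<bar>" by simp
qed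

text \<open>If the integral diverges it is \<open>0\<close> by convention, so nonnegativity holds in
  either case.\<close>

lemma set_integral_nonneg_vec:
  fixes f :: "real \<Rightarrow> 'a::ordered_euclidean_space"
  assumes "\<And>y. y \<in> A \<Longrightarrow> 0 \<le> f y"
  shows "0 \<le> (LBINT y:A. f y)"
proof (cases "set_integrable lborel A f")
  case True
  have "0 \<le> (LBINT y:A. f y) \<bullet> b" if b: "b \<in> Basis" for b
  proof -
    have "(LBINT y:A. f y) \<bullet> b = (\<integral>y. (indicator A y *\<^sub>R f y) \<bullet> b \<partial>lborel)"
      using True unfolding set_integrable_def set_lebesgue_integral_def
      by (intro integral_inner_left[symmetric]) auto
    moreover have "0 \<le> (indicator A y *\<^sub>R f y) \<bullet> b" for y
      using assms[of y] b by (auto simp: eucl_le[where 'a='a] indicator_def)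
    ultimately show ?thesis by simp
  qed
  then show ?thesis by (simp add: eucl_le[where 'a='a])
next
  case False
  then show ?thesis
    by (simp add: set_integrable_def set_lebesgue_integral_def not_integrable_integral_eq)
qed

lemma set_integral_mono_vec:
  fixes f g :: "real \<Rightarrow> 'a::ordered_euclidean_space"
  assumes "set_integrable lborel A f" "set_integrable lborel A g" "\<And>y. y \<in> A \<Longrightarrow> f y \<le> g y"
  shows "(LBINT y:A. f y) \<le> (LBINT y:A. g y)"
proof -
  have "0 \<le> (LBINT y:A. g y - f y)"
    using assms(3) by (intro set_integral_nonneg_vec) simp
  then show ?thesis using set_integral_diff(2)[OF assms(2,1)] by simp
qed

lemma set_integrable_dominated:
  fixes f g :: "real \<Rightarrow> 'a::ordered_euclidean_space"
  assumes "set_integrable lborel A g" "set_borel_measurable lborel A f"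
    "\<And>y. y \<in> A \<Longrightarrow> 0 \<le> f y" "\<And>y. y \<in> A \<Longrightarrow> f y \<le> g y"
  shows "set_integrable lborel A f"
  using assms(1,2) by (rule set_integrable_bound) (use assms(3,4) in \<open>auto intro: norm_mono_nonneg\<close>)

lemma set_integral_tendsto_dominated:
  fixes f :: "nat \<Rightarrow> real \<Rightarrow> 'a::ordered_euclidean_space"
  assumes g: "set_integrable lborel A g"
    and m: "\<And>m. set_borel_measurable lborel A (f m)" "set_borel_measurable lborel A f'"
    and b: "\<And>m y. y \<in> A \<Longrightarrow> 0 \<le> f m y" "\<And>m y. y \<in> A \<Longrightarrow> f m y \<le> g y"
    and l: "\<And>y. y \<in> A \<Longrightarrow> (\<lambda>m. f m y) \<longlonglongrightarrow> f' y"
  shows "(\<lambda>m. LBINT y:A. f m y) \<longlonglongrightarrow> (LBINT y:A. f' y)"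
  unfolding set_lebesgue_integral_def
proof (rule integral_dominated_convergence[where w="\<lambda>y. norm (indicator A y *\<^sub>R g y)"])
  show "(\<lambda>y. indicator A y *\<^sub>R f' y) \<in> borel_measurable lborel"
    "\<And>m. (\<lambda>y. indicator A y *\<^sub>R f m y) \<in> borel_measurable lborel"
    using m by (auto simp: set_borel_measurable_def)
  show "integrable lborel (\<lambda>y. norm (indicator A y *\<^sub>R g y))"
    using g unfolding set_integrable_def by (rule integrable_norm)
  show "AE y in lborel. (\<lambda>m. indicator A y *\<^sub>R f m y) \<longlonglongrightarrow> indicator A y *\<^sub>R f' y"
    using l by (auto simp: indicator_def)
  show "AE y in lborel. norm (indicator A y *\<^sub>R f m y) \<le> norm (indicator A y *\<^sub>R g y)" for m
    using b by (intro AE_I2) (auto simp: indicator_def intro: norm_mono_nonneg)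
qed

section \<open>Angular moments and the source\<close>

text \<open>Every angular integral in the source and in the temperature equation has this form. The
  weights that occur are nonnegative and bounded, so moments are monotone in the intensity and
  converge whenever the intensity is integrable over the directions.\<close>

definition moment :: "(real \<Rightarrow> real) \<Rightarrow> (real \<Rightarrow> real) \<Rightarrow> (real \<Rightarrow> real^2) \<Rightarrow> real" where
  "moment p q v = (LBINT \<mu>:{-1..1}. p \<mu> * v \<mu> $ 1 + q \<mu> * v \<mu> $ 2)"

text \<open>The constant 3 is a crude common bound for the Rayleigh kernels.\<close>

definition weight :: "(real \<Rightarrow> real) \<Rightarrow> bool" where
  "weight p \<longleftrightarrow> p \<in> borel_measurable borel \<and> (\<forall>\<mu>\<in>{-1..1}. 0 \<le> p \<mu> \<and> p \<mu> \<le> 3)"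

lemma nonneg_vec2: "0 \<le> (v::real^2) \<longleftrightarrow> 0 \<le> v $ 1 \<and> 0 \<le> v $ 2"
  by (simp add: less_eq_vec_def forall_2)

lemma le_vec2: "(u::real^2) \<le> v \<longleftrightarrow> u $ 1 \<le> v $ 1 \<and> u $ 2 \<le> v $ 2"
  by (simp add: less_eq_vec_def forall_2)

lemma borel_measurable_vec_nth2 [measurable (raw)]:
  fixes f :: "'a \<Rightarrow> real^2"
  assumes "f \<in> borel_measurable M"
  shows "(\<lambda>x. f x $ i) \<in> borel_measurable M"
proof -
  have "(\<lambda>x. f x \<bullet> axis i 1) \<in> borel_measurable M"
    using assms by measurable
  then show ?thesis by (simp add: inner_axis)
qed

lemma borel_measurable_vec2I [measurable (raw)]:
  fixes f g :: "'a \<Rightarrow> real"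
  assumes "f \<in> borel_measurable M" "g \<in> borel_measurable M"
  shows "(\<lambda>x. vector [f x, g x] :: real^2) \<in> borel_measurable M"
proof -
  have "(\<lambda>x. f x *\<^sub>R axis 1 1 + g x *\<^sub>R axis 2 1 :: real^2) \<in> borel_measurable M"
    using assms by measurable
  also have "(\<lambda>x. f x *\<^sub>R axis 1 1 + g x *\<^sub>R axis 2 1 :: real^2) = (\<lambda>x. vector [f x, g x])"
    by (auto simp: fun_eq_iff vec_eq_iff forall_2 axis_def)
  finally show ?thesis .
qed

lemma tendsto_vec2I:
  fixes f g :: "'a \<Rightarrow> real"
  assumes "(f \<longlongrightarrow> a) F" "(g \<longlongrightarrow> b) F"
  shows "((\<lambda>x. vector [f x, g x] :: real^2) \<longlongrightarrow> vector [a, b]) F"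
proof (rule vec_tendstoI)
  fix i :: 2
  have "i = 1 \<or> i = 2" by (rule exhaust_2)
  then show "((\<lambda>x. (vector [f x, g x] :: real^2) $ i) \<longlongrightarrow> (vector [a, b] :: real^2) $ i) F"
    using assms by auto
qed

text \<open>The direction \<open>\<mu> = 0\<close> carries no information about a state but lies in the range of the
  angular integrals; it is discarded as a null set. The intensity at \<open>\<mu> = 0\<close> may be
  arbitrary, so the integrands are compared pointwise off that point only.\<close>

lemma
  shows set_integral_dirs: "(LBINT \<mu>:{-1..1}. f \<mu>) = (LBINT \<mu>:dirs. f \<mu> :: 'a::euclidean_space)"
    and set_integrable_dirs: "set_integrable lborel {-1..1} f \<longleftrightarrow> set_integrable lborel dirs f"
  unfolding dirs_def
  by (rule set_integral_discrete_difference[of "{0}"] set_integrable_discrete_difference[of "{0}"]; auto)+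

lemma dirs_sets [measurable]: "dirs \<in> sets borel"
  by (simp add: dirs_def)

lemma set_integrable_moment:
  fixes v :: "real \<Rightarrow> real^2"
  assumes v: "set_integrable lborel {-1..1} v" and p: "weight p" and q: "weight q"
  shows "set_integrable lborel {-1..1} (\<lambda>\<mu>. p \<mu> * v \<mu> $ 1 + q \<mu> * v \<mu> $ 2)"
proof (rule set_integrable_bound[where f="\<lambda>\<mu>. 6 *\<^sub>R v \<mu>"])
  show "set_integrable lborel {-1..1} (\<lambda>\<mu>. 6 *\<^sub>R v \<mu>)" using v by simp
  have [measurable]: "p \<in> borel_measurable borel" "q \<in> borel_measurable borel"
    using p q by (auto simp: weight_def)
  have [measurable]: "(\<lambda>\<mu>. indicator {-1..1} \<mu> *\<^sub>R v \<mu>) \<in> borel_measurable borel"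
    using v by (auto simp: set_integrable_def)
  have "(\<lambda>\<mu>. p \<mu> * (indicator {-1..1} \<mu> *\<^sub>R v \<mu>) $ 1 + q \<mu> * (indicator {-1..1} \<mu> *\<^sub>R v \<mu>) $ 2)
      \<in> borel_measurable borel"
    by measurable
  then show "set_borel_measurable lborel {-1..1} (\<lambda>\<mu>. p \<mu> * v \<mu> $ 1 + q \<mu> * v \<mu> $ 2)"
    by (simp add: set_borel_measurable_def algebra_simps)
  show "AE \<mu> in lborel. \<mu> \<in> {-1..1} \<longrightarrow>
      norm (p \<mu> * v \<mu> $ 1 + q \<mu> * v \<mu> $ 2) \<le> norm (6 *\<^sub>R v \<mu>)"
  proof (intro AE_I2 impI)
    fix \<mu> :: real assume m: "\<mu> \<in> {-1..1}"
    have "\<bar>p \<mu> * v \<mu> $ 1\<bar> \<le> 3 * norm (v \<mu>)" "\<bar>q \<mu> * v \<mu> $ 2\<bar> \<le> 3 * norm (v \<mu>)"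
      using m p q by (auto simp: abs_mult weight_def intro!: mult_mono component_le_norm_cart)
    then show "norm (p \<mu> * v \<mu> $ 1 + q \<mu> * v \<mu> $ 2) \<le> norm (6 *\<^sub>R v \<mu>)" by simp
  qed
qed

lemma moment_nonneg:
  fixes v :: "real \<Rightarrow> real^2"
  assumes "\<And>\<mu>. \<mu> \<in> dirs \<Longrightarrow> 0 \<le> v \<mu>" "weight p" "weight q"
  shows "0 \<le> moment p q v"
  unfolding moment_def set_integral_dirs
  using assms by (intro set_integral_nonneg_vec) (auto simp: weight_def nonneg_vec2 dirs_def)

lemma moment_mono:
  assumes "set_integrable lborel {-1..1} u" "set_integrable lborel {-1..1} v"
    "\<And>\<mu>. \<mu> \<in> dirs \<Longrightarrow> u \<mu> \<le> v \<mu>" "weight p" "weight q"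
  shows "moment p q u \<le> moment p q v"
  unfolding moment_def set_integral_dirs
proof (rule set_integral_mono_vec)
  show "set_integrable lborel dirs (\<lambda>\<mu>. p \<mu> * u \<mu> $ 1 + q \<mu> * u \<mu> $ 2)"
    "set_integrable lborel dirs (\<lambda>\<mu>. p \<mu> * v \<mu> $ 1 + q \<mu> * v \<mu> $ 2)"
    using set_integrable_moment[OF assms(1,4,5)] set_integrable_moment[OF assms(2,4,5)]
    by (simp_all add: set_integrable_dirs)
  show "p \<mu> * u \<mu> $ 1 + q \<mu> * u \<mu> $ 2 \<le> p \<mu> * v \<mu> $ 1 + q \<mu> * v \<mu> $ 2" if "\<mu> \<in> dirs" for \<mu>
    using assms(3)[OF that] assms(4,5) that
    by (intro add_mono mult_left_mono) (auto simp: weight_def le_vec2 dirs_def)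
qed

lemma moment_tendsto:
  assumes w: "set_integrable lborel {-1..1} w"
    and m: "\<And>m. set_integrable lborel {-1..1} (v m)" "set_integrable lborel {-1..1} v'"
    and b: "\<And>m \<mu>. \<mu> \<in> dirs \<Longrightarrow> 0 \<le> v m \<mu>" "\<And>m \<mu>. \<mu> \<in> dirs \<Longrightarrow> v m \<mu> \<le> w \<mu>"
    and l: "\<And>\<mu>. \<mu> \<in> dirs \<Longrightarrow> (\<lambda>m. v m \<mu>) \<longlonglongrightarrow> v' \<mu>"
    and pq: "weight p" "weight q"
  shows "(\<lambda>m. moment p q (v m)) \<longlonglongrightarrow> moment p q v'"
  unfolding moment_def set_integral_dirs
proof (rule set_integral_tendsto_dominated)
  show "set_integrable lborel dirs (\<lambda>\<mu>. p \<mu> * w \<mu> $ 1 + q \<mu> * w \<mu> $ 2)"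
    using set_integrable_moment[OF w pq] by (simp add: set_integrable_dirs)
  show "set_borel_measurable lborel dirs (\<lambda>\<mu>. p \<mu> * v m \<mu> $ 1 + q \<mu> * v m \<mu> $ 2)" for m
    using set_integrable_moment[OF m(1) pq, of m]
    by (simp add: set_integrable_dirs) (auto simp: set_integrable_def set_borel_measurable_def)
  show "set_borel_measurable lborel dirs (\<lambda>\<mu>. p \<mu> * v' \<mu> $ 1 + q \<mu> * v' \<mu> $ 2)"
    using set_integrable_moment[OF m(2) pq]
    by (simp add: set_integrable_dirs) (auto simp: set_integrable_def set_borel_measurable_def)
  show "0 \<le> p \<mu> * v m \<mu> $ 1 + q \<mu> * v m \<mu> $ 2" if "\<mu> \<in> dirs" for m \<mu>
    using that b pq by (auto simp: weight_def nonneg_vec2 dirs_def)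
  show "p \<mu> * v m \<mu> $ 1 + q \<mu> * v m \<mu> $ 2 \<le> p \<mu> * w \<mu> $ 1 + q \<mu> * w \<mu> $ 2"
    if "\<mu> \<in> dirs" for m \<mu>
    using that b pq by (auto simp: weight_def le_vec2 dirs_def intro!: add_mono mult_left_mono)
  show "(\<lambda>m. p \<mu> * v m \<mu> $ 1 + q \<mu> * v m \<mu> $ 2) \<longlonglongrightarrow> p \<mu> * v' \<mu> $ 1 + q \<mu> * v' \<mu> $ 2"
    if "\<mu> \<in> dirs" for \<mu>
    using l[OF that] by (intro tendsto_intros)
qed

text \<open>The coefficient of \<open>I\<^sub>l\<close> in the Rayleigh part of the first source component.\<close>

definition rayleigh :: "real \<Rightarrow> real \<Rightarrow> real" where
  "rayleigh \<mu> \<mu>' = 2 * (1 - \<mu>'\<^sup>2) * (1 - \<mu>\<^sup>2) + \<mu>'\<^sup>2 * \<mu>\<^sup>2"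

lemma weight_rayleigh: "\<mu> \<in> {-1..1} \<Longrightarrow> weight (rayleigh \<mu>)"
proof -
  assume m: "\<mu> \<in> {-1..1}"
  have "0 \<le> rayleigh \<mu> x \<and> rayleigh \<mu> x \<le> 3" if "x \<in> {-1..1}" for x
  proof -
    have a: "0 \<le> \<mu>\<^sup>2" "\<mu>\<^sup>2 \<le> 1" "0 \<le> x\<^sup>2" "x\<^sup>2 \<le> 1"
      using m that by (auto simp: abs_square_le_1 abs_le_iff)
    then have "0 \<le> (1 - x\<^sup>2) * (1 - \<mu>\<^sup>2)" "(1 - x\<^sup>2) * (1 - \<mu>\<^sup>2) \<le> 1" "0 \<le> x\<^sup>2 * \<mu>\<^sup>2" "x\<^sup>2 * \<mu>\<^sup>2 \<le> 1"
      by (auto intro: mult_le_one)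
    then show ?thesis by (simp only: rayleigh_def mult.assoc) linarith
  qed
  then show ?thesis by (auto simp: weight_def rayleigh_def[abs_def])
qed

lemma weight_const: "0 \<le> a \<Longrightarrow> a \<le> 3 \<Longrightarrow> weight (\<lambda>_. a)"
  by (simp add: weight_def)

lemma weight_square: "weight power2"
  using abs_square_le_1 by (force simp: weight_def abs_le_iff)

lemma source_moments:
  "source D X z \<mu> \<nu> = vector
     [3 * ray D * kappa_s D z \<nu> / 8 * moment (rayleigh \<mu>) (\<lambda>_. \<mu>\<^sup>2) (\<lambda>\<mu>'. snd X z \<mu>' \<nu>)
       + (1 - ray D) * kappa_s D z \<nu> / 4 * moment (\<lambda>_. 1) (\<lambda>_. 1) (\<lambda>\<mu>'. snd X z \<mu>' \<nu>)
       + kappa_a D z \<nu> / 2 * planck_n D z \<nu> (fst X z),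
      3 * ray D * kappa_s D z \<nu> / 8 * moment power2 (\<lambda>_. 1) (\<lambda>\<mu>'. snd X z \<mu>' \<nu>)
       + (1 - ray D) * kappa_s D z \<nu> / 4 * moment (\<lambda>_. 1) (\<lambda>_. 1) (\<lambda>\<mu>'. snd X z \<mu>' \<nu>)
       + kappa_a D z \<nu> / 2 * planck_n D z \<nu> (fst X z)]"
  unfolding source_def moment_def rayleigh_def Let_def mult_1 by (rule refl)

section \<open>Joint measurability of the iteration map\<close>

text \<open>With refractive ratio 1 the two nested roots collapse. The three families of
  characteristics (unrefracted, and refracted in either sense) are therefore instances of
  \<open>eta_jump\<close>, and each statement about beams needs to be proved once.\<close>

lemma eta_eq_eta_jump: "eta D z \<mu> = eta_jump D 1 z \<mu>"
  by (auto simp: eta_jump_def eta_def pos_sqrt_def fun_eq_iff)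

text \<open>The reference point \<open>(z, \<mu>)\<close> enters this condition only through the single number
  \<open>n(z)\<^sup>2 (1 - \<mu>\<^sup>2)\<close>, the invariant of Snell's law, and the condition is antitone in it.\<close>

lemma eta_jump_pos_iff:
  assumes "0 < refr D y"
  shows "0 < eta_jump D r z \<mu> y \<longleftrightarrow>
     (refr D z)\<^sup>2 * (1 - \<mu>\<^sup>2) < (refr D y)\<^sup>2 \<and> r\<^sup>2 * ((refr D z)\<^sup>2 * (1 - \<mu>\<^sup>2)) < (refr D y)\<^sup>2"
  using assms
  by (auto simp: eta_jump_def eta_def pos_sqrt_def power_divide divide_simps)

lemma borel_of_antimono:
  fixes S :: "real set"
  assumes "\<And>s t. s \<le> t \<Longrightarrow> t \<in> S \<Longrightarrow> s \<in> S"
  shows "S \<in> sets borel"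
proof -
  have "is_interval S"
    using assms by (auto simp: is_interval_1)
  then show ?thesis by (rule real_interval_borel_measurable)
qed

lemma diag2_mult: "diag2 a b *v v = vector [a * v $ 1, b * v $ 2]"
  by (simp add: vec_eq_iff forall_2 diag2_def matrix_vector_mult_def sum_2)

lemma fresnel_X_mult: "fresnel_X n m *v v =
  (if n \<le> 1 \<or> mu_crit n < m
   then vector [((m - n * eta_F n m) / (m + n * eta_F n m))\<^sup>2 * v $ 1,
                ((n * m - eta_F n m) / (n * m + eta_F n m))\<^sup>2 * v $ 2] else v)"
  by (simp add: fresnel_X_def diag2_mult)

lemma fresnel_Y_mult: "fresnel_Y n m *v v =
  (if n \<le> 1 \<or> mu_crit n < m
   then vector [4 * n * m * eta_F n m / (m + n * eta_F n m)\<^sup>2 * v $ 1,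
                4 * n * m * eta_F n m / (n * m + eta_F n m)\<^sup>2 * v $ 2] else 0)"
  by (simp add: fresnel_Y_def diag2_mult)

text \<open>For data that are Borel on the whole space, every quantity of the iteration is jointly measurable
  in altitude, direction and frequency. This is what makes an iterate a measurable state again.\<close>

locale borel_data =
  fixes D :: medium and X :: state
  assumes refr_borel [measurable]: "refr D \<in> borel_measurable borel"
    and refr_pos: "\<And>z. 0 < refr D z"
    and kappa_borel: "(\<lambda>(z, \<nu>). kappa D z \<nu>) \<in> borel_measurable borel"
    and albedo_borel: "(\<lambda>(z, \<nu>). albedo D z \<nu>) \<in> borel_measurable borel"
    and inflow0_borel: "(\<lambda>(\<mu>, \<nu>). inflow0 D \<mu> \<nu>) \<in> borel_measurable borel"
    and inflowZ_borel: "(\<lambda>(\<mu>, \<nu>). inflowZ D \<mu> \<nu>) \<in> borel_measurable borel"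
    and temp_borel [measurable]: "fst X \<in> borel_measurable borel"
    and intensity_borel: "(\<lambda>(z, \<mu>, \<nu>). snd X z \<mu> \<nu>) \<in> borel_measurable borel"
begin

lemma measurable_data [measurable (raw)]:
  assumes "f \<in> borel_measurable M" "g \<in> borel_measurable M"
  shows "(\<lambda>x. kappa D (f x) (g x)) \<in> borel_measurable M"
    and "(\<lambda>x. albedo D (f x) (g x)) \<in> borel_measurable M"
    and "(\<lambda>x. inflow0 D (f x) (g x)) \<in> borel_measurable M"
    and "(\<lambda>x. inflowZ D (f x) (g x)) \<in> borel_measurable M"
proof -
  have p: "(\<lambda>x. (f x, g x)) \<in> borel_measurable M"
    using assms by (rule borel_measurable_Pair)
  show "(\<lambda>x. kappa D (f x) (g x)) \<in> borel_measurable M"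
    "(\<lambda>x. albedo D (f x) (g x)) \<in> borel_measurable M"
    "(\<lambda>x. inflow0 D (f x) (g x)) \<in> borel_measurable M"
    "(\<lambda>x. inflowZ D (f x) (g x)) \<in> borel_measurable M"
    using measurable_compose[OF p kappa_borel] measurable_compose[OF p albedo_borel]
      measurable_compose[OF p inflow0_borel] measurable_compose[OF p inflowZ_borel] by simp_all
qed

lemma measurable_intensity [measurable (raw)]:
  assumes "f \<in> borel_measurable M" "g \<in> borel_measurable M" "h \<in> borel_measurable M"
  shows "(\<lambda>x. snd X (f x) (g x) (h x)) \<in> borel_measurable M"
proof -
  have "(\<lambda>x. (f x, g x, h x)) \<in> borel_measurable M"
    using assms by (intro borel_measurable_Pair)
  from measurable_compose[OF this intensity_borel] show ?thesis by simp
qed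

lemma measurable_eta_jump [measurable (raw)]:
  assumes [measurable]: "f \<in> borel_measurable M" "g \<in> borel_measurable M" "h \<in> borel_measurable M"
  shows "(\<lambda>x. eta_jump D r (f x) (g x) (h x)) \<in> borel_measurable M"
  unfolding eta_jump_def eta_def pos_sqrt_def by measurable

text \<open>The transmission factor tests positivity of the cosine at all altitudes between two points, which
  is an uncountable intersection of conditions. The interval \<open>(a, b)\<close> is exhausted by its
  subintervals with rational end points, and for a fixed \<open>[p, q]\<close> the admissible values of the
  Snell invariant form a downward closed set of reals, hence a Borel set.\<close>

lemma pred_eta_jump_pos [measurable (raw)]:
  assumes [measurable]: "f \<in> borel_measurable M" "g \<in> borel_measurable M"
    "a \<in> borel_measurable M" "b \<in> borel_measurable M"
  shows "Measurable.pred M (\<lambda>x. \<forall>y\<in>{a x<..<b x} - {z_int D}. 0 < eta_jump D r (f x) (g x) y)"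
proof -
  \<comment> \<open>\<open>Q y\<close> holds trivially at the interface, which is exempt from the condition.\<close>
  define Q where "Q y s \<longleftrightarrow> y = z_int D \<or> s < (refr D y)\<^sup>2 \<and> r\<^sup>2 * s < (refr D y)\<^sup>2" for y s
  define s where "s x = (refr D (f x))\<^sup>2 * (1 - (g x)\<^sup>2)" for x
  define S where "S p q = {t. \<forall>y\<in>{real_of_rat p..real_of_rat q}. Q y t}" for p q
  have [measurable]: "s \<in> borel_measurable M"
    unfolding s_def[abs_def] by measurable
  have [measurable]: "S p q \<in> sets borel" for p q
  proof (rule borel_of_antimono)
    fix t u :: real assume "t \<le> u" "u \<in> S p q"
    moreover from \<open>t \<le> u\<close> have "r\<^sup>2 * t \<le> r\<^sup>2 * u" by (intro mult_left_mono) auto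
    ultimately show "t \<in> S p q" unfolding S_def Q_def by fastforce
  qed
  have "(\<forall>y\<in>{a x<..<b x} - {z_int D}. 0 < eta_jump D r (f x) (g x) y) \<longleftrightarrow>
     (\<forall>p q. a x < real_of_rat p \<longrightarrow> real_of_rat q < b x \<longrightarrow> s x \<in> S p q)" (is "?l = ?r") for x
  proof
    assume ?l
    then show ?r
      using refr_pos by (auto simp: S_def Q_def s_def eta_jump_pos_iff)
  next
    assume r: ?r
    show ?l
    proof
      fix y assume y: "y \<in> {a x<..<b x} - {z_int D}"
      obtain p q where "a x < real_of_rat p" "real_of_rat p < y" "y < real_of_rat q"
        "real_of_rat q < b x"
        using y of_rat_dense[of "a x" y] of_rat_dense[of y "b x"] by auto
      then have "y \<in> {real_of_rat p..real_of_rat q}" "s x \<in> S p q" using r by auto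
      then have "Q y (s x)" by (auto simp: S_def)
      then show "0 < eta_jump D r (f x) (g x) y"
        using y refr_pos by (auto simp: Q_def s_def eta_jump_pos_iff)
    qed
  qed
  then show ?thesis by simp
qed

lemma measurable_transm [measurable (raw)]:
  assumes [measurable]: "f \<in> borel_measurable M" "g \<in> borel_measurable M"
    "a \<in> borel_measurable M" "b \<in> borel_measurable M" "v \<in> borel_measurable M"
  shows "(\<lambda>x. transm D (eta_jump D r (f x) (g x)) (v x) (a x) (b x)) \<in> borel_measurable M"
proof -
  define k where "k x y = indicator {a x<..<b x} y *\<^sub>R (kappa D y (v x) / eta_jump D r (f x) (g x) y)"
    for x y
  have [measurable]: "(\<lambda>(x, y). k x y) \<in> borel_measurable (M \<Otimes>\<^sub>M lborel)"
    unfolding k_def indicator_def greaterThanLessThan_iff by measurable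
  have [measurable]: "(\<lambda>y. k x y) \<in> borel_measurable lborel" for x
    unfolding k_def by measurable
  have "integrable lborel (k x) \<longleftrightarrow> (\<integral>\<^sup>+ y. ennreal (norm (k x y)) \<partial>lborel) < \<infinity>" for x
    unfolding integrable_iff_bounded by simp
  moreover have "(\<lambda>x. \<integral>\<^sup>+ y. ennreal (norm (k x y)) \<partial>lborel) \<in> borel_measurable M"
    by measurable
  ultimately have "Measurable.pred M (\<lambda>x. integrable lborel (k x))"
    by simp
  moreover have "(\<lambda>x. LINT y|lborel. k x y) \<in> borel_measurable M" by measurable
  ultimately show ?thesis
    unfolding transm_def set_integrable_def set_lebesgue_integral_def k_def by measurable
qed

lemma measurable_moment [measurable (raw)]:
  assumes [measurable]: "(\<lambda>(x, \<mu>). p x \<mu>) \<in> borel_measurable (M \<Otimes>\<^sub>M lborel)"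
    "(\<lambda>(x, \<mu>). q x \<mu>) \<in> borel_measurable (M \<Otimes>\<^sub>M lborel)"
    "(\<lambda>(x, \<mu>). w x \<mu>) \<in> borel_measurable (M \<Otimes>\<^sub>M lborel)"
  shows "(\<lambda>x. moment (p x) (q x) (w x)) \<in> borel_measurable M"
  unfolding moment_def set_lebesgue_integral_def by measurable

lemma measurable_source [measurable (raw)]:
  assumes [measurable]: "f \<in> borel_measurable M" "g \<in> borel_measurable M" "v \<in> borel_measurable M"
  shows "(\<lambda>x. source D X (f x) (g x) (v x)) \<in> borel_measurable M"
  unfolding source_moments kappa_s_def kappa_a_def planck_n_def planck_def rayleigh_def by measurable

lemma measurable_src_along [measurable (raw)]:
  assumes [measurable]: "f \<in> borel_measurable M" "g \<in> borel_measurable M"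
    "v \<in> borel_measurable M" "h \<in> borel_measurable M"
  shows "(\<lambda>x. src_along D X (eta_jump D r (f x) (g x)) (v x) (h x)) \<in> borel_measurable M"
  unfolding src_along_def by measurable

lemma measurable_beams [measurable (raw)]:
  assumes [measurable]: "f \<in> borel_measurable M" "g \<in> borel_measurable M"
    "v \<in> borel_measurable M" "h \<in> borel_measurable M"
  shows "(\<lambda>x. beam_up D X (eta_jump D r (f x) (g x)) (v x) (h x)) \<in> borel_measurable M"
    and "(\<lambda>x. beam_down D X (eta_jump D r (f x) (g x)) (v x) (h x)) \<in> borel_measurable M"
  unfolding beam_up_def beam_down_def inflow0_along_def inflowZ_along_def
    set_lebesgue_integral_def indicator_def greaterThanLessThan_iff by measurable

lemma measurable_next_I [measurable (raw)]:
  assumes [measurable]: "f \<in> borel_measurable M" "g \<in> borel_measurable M" "v \<in> borel_measurable M"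
  shows "(\<lambda>x. next_I D X (f x) (g x) (v x)) \<in> borel_measurable M"
proof -
  have "(\<lambda>x. jump D X (f x) (g x) (v x)) \<in> borel_measurable M"
    unfolding jump_def Let_def eta_eq_eta_jump fresnel_X_mult fresnel_Y_mult eta_F_def by measurable
  then show ?thesis
    unfolding next_I_def Let_def eta_eq_eta_jump by measurable
qed

lemma measurable_absorbed [measurable (raw)]:
  assumes [measurable]: "f \<in> borel_measurable M" "v \<in> borel_measurable M"
  shows "(\<lambda>x. absorbed D (next_I D X) (f x) (v x)) \<in> borel_measurable M"
  unfolding absorbed_def kappa_a_def set_lebesgue_integral_def by measurable

lemma measurable_emitted [measurable (raw)]:
  assumes [measurable]: "t \<in> borel_measurable M" "f \<in> borel_measurable M" "v \<in> borel_measurable M"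
  shows "(\<lambda>x. emitted D (t x) (f x) (v x)) \<in> borel_measurable M"
  unfolding emitted_def planck_n_def planck_def kappa_a_def by measurable

end

section \<open>Passing to Borel data on the whole space\<close>

text \<open>Medium and state are given only on their domains of definition. Changing them outside, to
  constants, produces Borel data on the whole space with the same update of the intensities on
  the domain.\<close>

definition cut_medium :: "medium \<Rightarrow> medium" where
  "cut_medium D = D
     \<lparr>refr := (\<lambda>z. if z \<in> {0..z_top D} then refr D z else 1),
      kappa := (\<lambda>z \<nu>. if (z, \<nu>) \<in> alts D \<times> freqs then kappa D z \<nu> else 0),
      albedo := (\<lambda>z \<nu>. if (z, \<nu>) \<in> alts D \<times> freqs then albedo D z \<nu> else 0),
      inflow0 := (\<lambda>\<mu> \<nu>. if (\<mu>, \<nu>) \<in> {0<..1} \<times> freqs then inflow0 D \<mu> \<nu> else 0),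
      inflowZ := (\<lambda>\<mu> \<nu>. if (\<mu>, \<nu>) \<in> {-1..<0} \<times> freqs then inflowZ D \<mu> \<nu> else 0)\<rparr>"

definition cut_state :: "medium \<Rightarrow> state \<Rightarrow> state" where
  "cut_state D X =
     ((\<lambda>z. if z \<in> alts D then fst X z else 0),
      (\<lambda>z \<mu> \<nu>. if (z, \<mu>, \<nu>) \<in> alts D \<times> dirs \<times> freqs then snd X z \<mu> \<nu> else 0))"

lemma alts_sets [measurable]: "alts D \<in> sets borel"
  by (simp add: alts_def)

lemma freqs_sets [measurable]: "freqs \<in> sets borel"
  by (simp add: freqs_def)

lemma borel_measurable_cut:
  fixes f :: "'a::topological_space \<Rightarrow> 'b::real_normed_vector"
  assumes "A \<in> sets borel"
  shows "f \<in> borel_measurable (restrict_space borel A) \<longleftrightarrow>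
    (\<lambda>x. if x \<in> A then f x else 0) \<in> borel_measurable borel"
proof -
  have "(\<lambda>x. indicator A x *\<^sub>R f x) = (\<lambda>x. if x \<in> A then f x else 0)"
    by (auto simp: fun_eq_iff)
  then show ?thesis using assms by (simp add: borel_measurable_restrict_space_iff)
qed

lemma borel_measurable_cut_pair:
  fixes f :: "real \<Rightarrow> real \<Rightarrow> 'b::real_normed_vector"
  assumes "(\<lambda>(x, y). f x y) \<in> borel_measurable (restrict_space borel (A \<times> B))"
    and [measurable]: "A \<in> sets borel" "B \<in> sets borel"
  shows "(\<lambda>(x, y). if (x, y) \<in> A \<times> B then f x y else 0) \<in> borel_measurable borel"
proof -
  have "A \<times> B \<in> sets (borel :: (real \<times> real) measure)"
    using assms(2,3) by (rule borel_Times)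
  then have "(\<lambda>p. if p \<in> A \<times> B then (case p of (x, y) \<Rightarrow> f x y) else 0) \<in> borel_measurable borel"
    using assms(1) by (simp only: borel_measurable_cut)
  also have "(\<lambda>p. if p \<in> A \<times> B then (case p of (x, y) \<Rightarrow> f x y) else 0)
      = (\<lambda>(x, y). if (x, y) \<in> A \<times> B then f x y else 0)"
    by (auto simp: fun_eq_iff)
  finally show ?thesis .
qed

lemma domain_sets: "alts D \<times> dirs \<times> freqs \<in> sets (borel :: (real \<times> real \<times> real) measure)"
  by (intro borel_Times) measurable

text \<open>The index is smooth off the altitudes \<open>0\<close>, \<open>Y\<close> and \<open>Z\<close>; its values at these three points do
  not affect measurability.\<close>

lemma measurable_refr_cut:
  assumes "medium_ok D"
  shows "(\<lambda>z. if z \<in> {0..z_top D} then refr D z else 1) \<in> borel_measurable borel"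
proof -
  have c: "continuous_on S (refr D)" if "smooth_on S (refr D)" for S
  proof (rule continuous_at_imp_continuous_on, rule ballI)
    fix x assume "x \<in> S"
    then have "(deriv ^^ 0) (refr D) field_differentiable (at x)"
      using that unfolding smooth_on_def by blast
    then show "isCont (refr D) x" by (simp add: field_differentiable_imp_continuous_at)
  qed
  let ?A = "{0<..<z_int D}" and ?B = "{z_int D<..<z_top D}"
  have [measurable]: "(\<lambda>z. indicator ?A z *\<^sub>R refr D z) \<in> borel_measurable borel"
    "(\<lambda>z. indicator ?B z *\<^sub>R refr D z) \<in> borel_measurable borel"
    using assms unfolding medium_ok_def
    by (intro borel_measurable_continuous_on_indicator c; simp)+
  have "(\<lambda>z. if z = 0 then refr D 0 else if z = z_int D then refr D (z_int D)
      else if z = z_top D then refr D (z_top D)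
      else if z < 0 \<or> z_top D < z then 1
      else indicator ?A z *\<^sub>R refr D z + indicator ?B z *\<^sub>R refr D z) \<in> borel_measurable borel"
    by measurable
  also have "(\<lambda>z. if z = 0 then refr D 0 else if z = z_int D then refr D (z_int D)
      else if z = z_top D then refr D (z_top D)
      else if z < 0 \<or> z_top D < z then 1
      else indicator ?A z *\<^sub>R refr D z + indicator ?B z *\<^sub>R refr D z)
      = (\<lambda>z. if z \<in> {0..z_top D} then refr D z else 1)"
    using assms by (auto simp: medium_ok_def fun_eq_iff indicator_def)
  finally show ?thesis .
qed

lemma borel_data_cut:
  assumes D: "medium_ok D" and X: "measurable_state D X"
  shows "borel_data (cut_medium D) (cut_state D X)"
proof
  show "refr (cut_medium D) \<in> borel_measurable borel"
    using measurable_refr_cut[OF D] by (simp add: cut_medium_def)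
  show "0 < refr (cut_medium D) z" for z
    using D by (simp add: cut_medium_def medium_ok_def)
  have s: "{0<..1::real} \<in> sets borel" "{-1..<0::real} \<in> sets borel" by auto
  show "(\<lambda>(z, \<nu>). kappa (cut_medium D) z \<nu>) \<in> borel_measurable borel"
    "(\<lambda>(z, \<nu>). albedo (cut_medium D) z \<nu>) \<in> borel_measurable borel"
    "(\<lambda>(z, \<nu>). inflow0 (cut_medium D) z \<nu>) \<in> borel_measurable borel"
    "(\<lambda>(z, \<nu>). inflowZ (cut_medium D) z \<nu>) \<in> borel_measurable borel"
    using D borel_measurable_cut_pair[OF _ alts_sets freqs_sets, of "kappa D" D]
      borel_measurable_cut_pair[OF _ alts_sets freqs_sets, of "albedo D" D]
      borel_measurable_cut_pair[OF _ s(1) freqs_sets, of "inflow0 D"]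
      borel_measurable_cut_pair[OF _ s(2) freqs_sets, of "inflowZ D"]
    unfolding medium_ok_def cut_medium_def by simp_all
  show "fst (cut_state D X) \<in> borel_measurable borel"
    using X borel_measurable_cut[OF alts_sets, of "fst X" D]
    by (simp add: measurable_state_def cut_state_def)
  have "(\<lambda>p. if p \<in> alts D \<times> dirs \<times> freqs then (case p of (z, \<mu>, \<nu>) \<Rightarrow> snd X z \<mu> \<nu>) else 0)
      \<in> borel_measurable borel"
    using X borel_measurable_cut[OF domain_sets, of "\<lambda>(z, \<mu>, \<nu>). snd X z \<mu> \<nu>" D]
    by (simp only: measurable_state_def)
  also have "(\<lambda>p. if p \<in> alts D \<times> dirs \<times> freqs then (case p of (z, \<mu>, \<nu>) \<Rightarrow> snd X z \<mu> \<nu>) else 0)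
      = (\<lambda>(z, \<mu>, \<nu>). snd (cut_state D X) z \<mu> \<nu>)"
    by (auto simp: fun_eq_iff cut_state_def)
  finally show "(\<lambda>(z, \<mu>, \<nu>). snd (cut_state D X) z \<mu> \<nu>) \<in> borel_measurable borel" .
qed

lemma cut_sel [simp]:
  "z_int (cut_medium D) = z_int D" "z_top (cut_medium D) = z_top D" "ray (cut_medium D) = ray D"
  "n_above (cut_medium D) = n_above D" "n_below (cut_medium D) = n_below D"
  "ratio_pm (cut_medium D) = ratio_pm D" "ratio_mp (cut_medium D) = ratio_mp D"
  "alts (cut_medium D) = alts D"
  by (simp_all add: cut_medium_def ratio_pm_def ratio_mp_def alts_def)

lemma eta_jump_cut:
  assumes "z \<in> {0..z_top D}" "y \<in> {0..z_top D}"
  shows "eta_jump (cut_medium D) r z \<mu> y = eta_jump D r z \<mu> y"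
  using assms by (simp add: eta_jump_def eta_def cut_medium_def)

text \<open>Every cosine produced on a characteristic is again a direction cosine, so that the source and
  the boundary values are evaluated inside their domains.\<close>

lemma eta_jump_bounds:
  assumes "\<mu> \<in> {-1..1}"
  shows "0 \<le> eta_jump D r z \<mu> y" "eta_jump D r z \<mu> y \<le> 1"
proof -
  have b: "0 \<le> pos_sqrt (1 - x)" "pos_sqrt (1 - x) \<le> 1" if "0 \<le> x" for x
    using that by (auto simp: pos_sqrt_def)
  have "\<mu>\<^sup>2 \<le> 1" using assms by (auto simp: abs_square_le_1 abs_le_iff)
  then have e: "0 \<le> eta D z \<mu> y" "eta D z \<mu> y \<le> 1"
    unfolding eta_def by (auto intro!: b)
  then have "(eta D z \<mu> y)\<^sup>2 \<le> 1" by (simp add: abs_square_le_1)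
  then have "0 \<le> r\<^sup>2 * (1 - (eta D z \<mu> y)\<^sup>2)" by simp
  from b[OF this] show "0 \<le> eta_jump D r z \<mu> y" "eta_jump D r z \<mu> y \<le> 1"
    by (simp_all add: eta_jump_def)
qed

lemma transm_cut:
  assumes "z \<in> {0..z_top D}" "0 \<le> a" "b \<le> z_top D" "\<nu> \<in> freqs"
  shows "transm (cut_medium D) (eta_jump (cut_medium D) r z \<mu>) \<nu> a b = transm D (eta_jump D r z \<mu>) \<nu> a b"
proof -
  have e: "eta_jump (cut_medium D) r z \<mu> y = eta_jump D r z \<mu> y" if "y \<in> {a<..<b}" for y
    using that assms by (intro eta_jump_cut) auto
  have k: "kappa (cut_medium D) y \<nu> / eta_jump (cut_medium D) r z \<mu> y
      = kappa D y \<nu> / eta_jump D r z \<mu> y" if "y \<in> {a<..<b}" for y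
    using that assms by (subst e) (auto simp: cut_medium_def alts_def)
  have "(\<forall>y\<in>{a<..<b} - {z_int D}. 0 < eta_jump (cut_medium D) r z \<mu> y)
      \<longleftrightarrow> (\<forall>y\<in>{a<..<b} - {z_int D}. 0 < eta_jump D r z \<mu> y)"
    using e by auto
  moreover have "set_integrable lborel {a<..<b}
        (\<lambda>y. kappa (cut_medium D) y \<nu> / eta_jump (cut_medium D) r z \<mu> y)
      \<longleftrightarrow> set_integrable lborel {a<..<b} (\<lambda>y. kappa D y \<nu> / eta_jump D r z \<mu> y)"
    using k by (intro set_integrable_cong) auto
  moreover have "(LBINT y:{a<..<b}. kappa (cut_medium D) y \<nu> / eta_jump (cut_medium D) r z \<mu> y)
      = (LBINT y:{a<..<b}. kappa D y \<nu> / eta_jump D r z \<mu> y)"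
    using k by (intro set_lebesgue_integral_cong) auto
  ultimately show ?thesis by (simp add: transm_def)
qed

lemma source_cut:
  assumes "y \<in> alts D" "\<nu> \<in> freqs"
  shows "source (cut_medium D) (cut_state D X) y m \<nu> = source D X y m \<nu>"
proof -
  have "moment p q (\<lambda>\<mu>. snd (cut_state D X) y \<mu> \<nu>) = moment p q (\<lambda>\<mu>. snd X y \<mu> \<nu>)" for p q
    unfolding moment_def set_integral_dirs using assms
    by (intro set_lebesgue_integral_cong) (auto simp: cut_state_def)
  then show ?thesis
    using assms unfolding source_moments
    by (simp add: cut_state_def cut_medium_def kappa_s_def kappa_a_def planck_n_def alts_def)
qed

lemma src_along_cut:
  assumes "z \<in> {0..z_top D}" "y \<in> alts D" "\<nu> \<in> freqs"
  shows "src_along (cut_medium D) (cut_state D X) (eta_jump (cut_medium D) r z \<mu>) \<nu> y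
    = src_along D X (eta_jump D r z \<mu>) \<nu> y"
  using assms eta_jump_cut[of z D y r \<mu>] by (simp add: src_along_def source_cut alts_def)

lemma beam_up_cut:
  assumes "medium_ok D" "z \<in> {0..z_top D}" "h \<in> alts D" "\<nu> \<in> freqs" "\<mu> \<in> {-1..1}"
  shows "beam_up (cut_medium D) (cut_state D X) (eta_jump (cut_medium D) r z \<mu>) \<nu> h
    = beam_up D X (eta_jump D r z \<mu>) \<nu> h"
proof -
  have "eta_jump (cut_medium D) r z \<mu> 0 = eta_jump D r z \<mu> 0"
    using assms by (intro eta_jump_cut) (auto simp: medium_ok_def)
  then have "inflow0_along (cut_medium D) (eta_jump (cut_medium D) r z \<mu>) \<nu>
      = inflow0_along D (eta_jump D r z \<mu>) \<nu>"
    using assms eta_jump_bounds[OF assms(5)] by (simp add: inflow0_along_def cut_medium_def)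
  moreover have "(LBINT y:{0<..<h}. transm (cut_medium D) (eta_jump (cut_medium D) r z \<mu>) \<nu> y h
        *\<^sub>R src_along (cut_medium D) (cut_state D X) (eta_jump (cut_medium D) r z \<mu>) \<nu> y)
      = (LBINT y:{0<..<h}. transm D (eta_jump D r z \<mu>) \<nu> y h *\<^sub>R src_along D X (eta_jump D r z \<mu>) \<nu> y)"
    using assms by (intro set_lebesgue_integral_cong) (auto simp: src_along_cut transm_cut alts_def)
  ultimately show ?thesis
    using assms by (simp add: beam_up_def transm_cut alts_def)
qed

lemma beam_down_cut:
  assumes "medium_ok D" "z \<in> {0..z_top D}" "h \<in> alts D" "\<nu> \<in> freqs" "\<mu> \<in> {-1..1}"
  shows "beam_down (cut_medium D) (cut_state D X) (eta_jump (cut_medium D) r z \<mu>) \<nu> h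
    = beam_down D X (eta_jump D r z \<mu>) \<nu> h"
proof -
  have "eta_jump (cut_medium D) r z \<mu> (z_top D) = eta_jump D r z \<mu> (z_top D)"
    using assms by (intro eta_jump_cut) (auto simp: medium_ok_def)
  then have "inflowZ_along (cut_medium D) (eta_jump (cut_medium D) r z \<mu>) \<nu>
      = inflowZ_along D (eta_jump D r z \<mu>) \<nu>"
    using assms eta_jump_bounds[OF assms(5)] by (simp add: inflowZ_along_def cut_medium_def)
  moreover have "(LBINT y:{h<..<z_top D}. transm (cut_medium D) (eta_jump (cut_medium D) r z \<mu>) \<nu> h y
        *\<^sub>R src_along (cut_medium D) (cut_state D X) (eta_jump (cut_medium D) r z \<mu>) \<nu> y)
      = (LBINT y:{h<..<z_top D}. transm D (eta_jump D r z \<mu>) \<nu> h y *\<^sub>R src_along D X (eta_jump D r z \<mu>) \<nu> y)"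
    using assms by (intro set_lebesgue_integral_cong) (auto simp: src_along_cut transm_cut alts_def)
  ultimately show ?thesis
    using assms by (simp add: beam_down_def transm_cut alts_def)
qed

lemma z_int_alts: "medium_ok D \<Longrightarrow> z_int D \<in> alts D"
  by (simp add: medium_ok_def alts_def)

lemma next_I_cut:
  assumes "medium_ok D" "z \<in> alts D" "\<nu> \<in> freqs" "\<mu> \<in> {-1..1}"
  shows "next_I (cut_medium D) (cut_state D X) z \<mu> \<nu> = next_I D X z \<mu> \<nu>"
proof -
  have z: "z \<in> {0..z_top D}" using assms by (auto simp: alts_def)
  have "jump (cut_medium D) (cut_state D X) z \<mu> \<nu> = jump D X z \<mu> \<nu>"
    unfolding jump_def Let_def eta_eq_eta_jump using assms z z_int_alts[OF assms(1)]
    by (simp add: beam_up_cut beam_down_cut)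
  moreover have "transm (cut_medium D) (eta_jump (cut_medium D) 1 z \<mu>) \<nu> (z_int D) z
      = transm D (eta_jump D 1 z \<mu>) \<nu> (z_int D) z"
    "transm (cut_medium D) (eta_jump (cut_medium D) 1 z \<mu>) \<nu> z (z_int D)
      = transm D (eta_jump D 1 z \<mu>) \<nu> z (z_int D)"
    using assms z by (intro transm_cut; auto simp: medium_ok_def)+
  ultimately show ?thesis
    unfolding next_I_def Let_def eta_eq_eta_jump using assms z
    by (simp add: beam_up_cut beam_down_cut)
qed

lemma absorbed_cut:
  assumes "medium_ok D" "z \<in> alts D" "\<nu> \<in> freqs"
  shows "absorbed (cut_medium D) (next_I (cut_medium D) (cut_state D X)) z \<nu> = absorbed D (next_I D X) z \<nu>"
proof -
  have "(LBINT \<mu>:{-1..1}. next_I (cut_medium D) (cut_state D X) z \<mu> \<nu> $ 1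
        + next_I (cut_medium D) (cut_state D X) z \<mu> \<nu> $ 2)
      = (LBINT \<mu>:{-1..1}. next_I D X z \<mu> \<nu> $ 1 + next_I D X z \<mu> \<nu> $ 2)"
    using assms by (intro set_lebesgue_integral_cong) (auto simp: next_I_cut)
  then show ?thesis using assms
    by (simp add: absorbed_def kappa_a_def) (simp add: cut_medium_def)
qed

lemma emitted_cut:
  assumes "z \<in> alts D" "\<nu> \<in> freqs"
  shows "emitted (cut_medium D) t z \<nu> = emitted D t z \<nu>"
  using assms by (simp add: emitted_def kappa_a_def planck_n_def cut_medium_def alts_def)

section \<open>Measurability of the quantities entering the iteration\<close>

lemma set_borel_measurable_congI:
  fixes f g :: "real \<Rightarrow> 'a::{real_normed_vector, second_countable_topology}"
  assumes "g \<in> borel_measurable borel" "A \<in> sets borel" "\<And>y. y \<in> A \<Longrightarrow> f y = g y"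
  shows "set_borel_measurable lborel A f"
proof -
  have "(\<lambda>y. indicator A y *\<^sub>R f y) = (\<lambda>y. indicator A y *\<^sub>R g y)"
    using assms(3) by (auto simp: fun_eq_iff indicator_def)
  then show ?thesis using assms(1,2) unfolding set_borel_measurable_def by simp
qed

lemma
  assumes D: "medium_ok D" and X: "measurable_state D X" and z: "z \<in> alts D"
  shows measurable_intensity_section:
      "\<nu> \<in> freqs \<Longrightarrow> set_borel_measurable lborel {-1..1} (\<lambda>\<mu>. snd X z \<mu> \<nu>)"
    and measurable_next_I_section:
      "\<nu> \<in> freqs \<Longrightarrow> set_borel_measurable lborel {-1..1} (\<lambda>\<mu>. next_I D X z \<mu> \<nu>)"
    and measurable_absorbed_section: "set_borel_measurable lborel freqs (absorbed D (next_I D X) z)"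
    and measurable_emitted_section: "set_borel_measurable lborel freqs (emitted D t z)"
    and measurable_up_integrand:
      "\<nu> \<in> freqs \<Longrightarrow> \<mu> \<in> {-1..1} \<Longrightarrow> b \<le> z_top D \<Longrightarrow> A \<in> sets borel \<Longrightarrow> A \<subseteq> alts D \<Longrightarrow>
       set_borel_measurable lborel A
         (\<lambda>y. transm D (eta_jump D r z \<mu>) \<nu> y b *\<^sub>R src_along D X (eta_jump D r z \<mu>) \<nu> y)"
    and measurable_down_integrand:
      "\<nu> \<in> freqs \<Longrightarrow> \<mu> \<in> {-1..1} \<Longrightarrow> 0 \<le> b \<Longrightarrow> A \<in> sets borel \<Longrightarrow> A \<subseteq> alts D \<Longrightarrow>
       set_borel_measurable lborel A
         (\<lambda>y. transm D (eta_jump D r z \<mu>) \<nu> b y *\<^sub>R src_along D X (eta_jump D r z \<mu>) \<nu> y)"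
proof -
  interpret borel_data "cut_medium D" "cut_state D X" by (rule borel_data_cut[OF D X])
  have z': "z \<in> {0..z_top D}" using z by (auto simp: alts_def)
  show "set_borel_measurable lborel {-1..1} (\<lambda>\<mu>. next_I D X z \<mu> \<nu>)" if "\<nu> \<in> freqs"
    by (rule set_borel_measurable_congI[where g="\<lambda>\<mu>. next_I (cut_medium D) (cut_state D X) z \<mu> \<nu>"])
       (use D z that in \<open>auto simp: next_I_cut\<close>)
  show "set_borel_measurable lborel freqs (absorbed D (next_I D X) z)"
    by (rule set_borel_measurable_congI[where g="\<lambda>\<nu>. absorbed (cut_medium D) (next_I (cut_medium D) (cut_state D X)) z \<nu>"])
       (use D z in \<open>auto simp: absorbed_cut\<close>)
  show "set_borel_measurable lborel freqs (emitted D t z)"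
    by (rule set_borel_measurable_congI[where g="\<lambda>\<nu>. emitted (cut_medium D) t z \<nu>"])
       (use D z in \<open>auto simp: emitted_cut\<close>)
  show "set_borel_measurable lborel A
         (\<lambda>y. transm D (eta_jump D r z \<mu>) \<nu> y b *\<^sub>R src_along D X (eta_jump D r z \<mu>) \<nu> y)"
    if "\<nu> \<in> freqs" "\<mu> \<in> {-1..1}" "b \<le> z_top D" "A \<in> sets borel" "A \<subseteq> alts D"
  proof (rule set_borel_measurable_congI[where g="\<lambda>y. transm (cut_medium D) (eta_jump (cut_medium D) r z \<mu>) \<nu> y b
        *\<^sub>R src_along (cut_medium D) (cut_state D X) (eta_jump (cut_medium D) r z \<mu>) \<nu> y"])
    fix y assume "y \<in> A"
    then have "y \<in> alts D" "0 \<le> y" using that by (auto simp: alts_def)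
    then show "transm D (eta_jump D r z \<mu>) \<nu> y b *\<^sub>R src_along D X (eta_jump D r z \<mu>) \<nu> y
      = transm (cut_medium D) (eta_jump (cut_medium D) r z \<mu>) \<nu> y b
        *\<^sub>R src_along (cut_medium D) (cut_state D X) (eta_jump (cut_medium D) r z \<mu>) \<nu> y"
      using that z' by (simp add: transm_cut src_along_cut)
  qed (use that in auto)
  show "set_borel_measurable lborel A
         (\<lambda>y. transm D (eta_jump D r z \<mu>) \<nu> b y *\<^sub>R src_along D X (eta_jump D r z \<mu>) \<nu> y)"
    if "\<nu> \<in> freqs" "\<mu> \<in> {-1..1}" "0 \<le> b" "A \<in> sets borel" "A \<subseteq> alts D"
  proof (rule set_borel_measurable_congI[where g="\<lambda>y. transm (cut_medium D) (eta_jump (cut_medium D) r z \<mu>) \<nu> b y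
        *\<^sub>R src_along (cut_medium D) (cut_state D X) (eta_jump (cut_medium D) r z \<mu>) \<nu> y"])
    fix y assume "y \<in> A"
    then have "y \<in> alts D" "y \<le> z_top D" using that by (auto simp: alts_def)
    then show "transm D (eta_jump D r z \<mu>) \<nu> b y *\<^sub>R src_along D X (eta_jump D r z \<mu>) \<nu> y
      = transm (cut_medium D) (eta_jump (cut_medium D) r z \<mu>) \<nu> b y
        *\<^sub>R src_along (cut_medium D) (cut_state D X) (eta_jump (cut_medium D) r z \<mu>) \<nu> y"
      using that z' by (simp add: transm_cut src_along_cut)
  qed (use that in auto)
  show "set_borel_measurable lborel {-1..1} (\<lambda>\<mu>. snd X z \<mu> \<nu>)" if "\<nu> \<in> freqs"
    \<comment> \<open>The value at \<open>\<mu> = 0\<close> is not controlled by measurability of the state; one point is harmless.\<close>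
    by (rule set_borel_measurable_congI[where g="\<lambda>\<mu>. if \<mu> = 0 then snd X z 0 \<nu> else snd (cut_state D X) z \<mu> \<nu>"])
       (use z that in \<open>auto simp: cut_state_def dirs_def\<close>)
qed

lemma measurable_next_I_domain:
  assumes D: "medium_ok D" and X: "measurable_state D X"
  shows "(\<lambda>(z, \<mu>, \<nu>). next_I D X z \<mu> \<nu>)
    \<in> borel_measurable (restrict_space borel (alts D \<times> dirs \<times> freqs))"
proof -
  interpret borel_data "cut_medium D" "cut_state D X" by (rule borel_data_cut[OF D X])
  have "(\<lambda>p. next_I (cut_medium D) (cut_state D X) (fst p) (fst (snd p)) (snd (snd p)))
      \<in> borel_measurable (borel :: (real \<times> real \<times> real) measure)"
    unfolding borel_prod[symmetric] by measurable
  then have "(\<lambda>p. next_I (cut_medium D) (cut_state D X) (fst p) (fst (snd p)) (snd (snd p)))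
      \<in> borel_measurable (restrict_space borel (alts D \<times> dirs \<times> freqs))"
    by (rule measurable_restrict_space1)
  then show ?thesis
    by (rule measurable_cong[THEN iffD1, rotated])
       (use D in \<open>auto simp: space_restrict_space next_I_cut dirs_def\<close>)
qed

section \<open>The temperature equation\<close>

lemma planck_nonneg: "0 < \<nu> \<Longrightarrow> 0 \<le> t \<Longrightarrow> 0 \<le> planck \<nu> t"
  by (auto simp: planck_def)

text \<open>The Rayleigh--Jeans bound; it gives continuity of the Planck function at temperature 0.\<close>

lemma planck_le:
  assumes "0 < \<nu>" "0 \<le> t"
  shows "planck \<nu> t \<le> \<nu>\<^sup>2 * t"
proof (cases "t = 0")
  case False
  then have t: "0 < t" using assms by simp
  have "\<nu> / t \<le> exp (\<nu> / t) - 1" using exp_ge_add_one_self[of "\<nu> / t"] by linarith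
  then have "\<nu> ^ 3 / (exp (\<nu> / t) - 1) \<le> \<nu> ^ 3 / (\<nu> / t)"
    using t assms by (intro divide_left_mono) auto
  also have "\<dots> = \<nu>\<^sup>2 * t" using t assms by (simp add: power2_eq_square power3_eq_cube)
  finally show ?thesis using t by (simp add: planck_def)
qed (simp add: planck_def)

lemma planck_strict_mono:
  assumes "0 < \<nu>" "0 \<le> s" "s < t"
  shows "planck \<nu> s < planck \<nu> t"
proof (cases "s = 0")
  case True
  then show ?thesis using assms by (simp add: planck_def)
next
  case False
  then have "0 < s" using assms by simp
  then have "\<nu> / t < \<nu> / s" "0 < \<nu> / t" "0 < \<nu> / s"
    using assms by (simp_all add: divide_strict_left_mono)
  then have "exp (\<nu> / t) < exp (\<nu> / s)" "1 < exp (\<nu> / t)" "1 < exp (\<nu> / s)"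
    by (simp_all only: exp_less_cancel_iff one_less_exp_iff)
  then have "\<nu> ^ 3 / (exp (\<nu> / s) - 1) < \<nu> ^ 3 / (exp (\<nu> / t) - 1)"
    using assms by (intro divide_strict_left_mono mult_pos_pos) simp_all
  then show ?thesis using False assms by (simp add: planck_def)
qed

lemma planck_tendsto:
  assumes \<nu>: "0 < \<nu>" and t: "T \<longlonglongrightarrow> t" "\<And>m. 0 \<le> T m" "0 \<le> t"
  shows "(\<lambda>m::nat. planck \<nu> (T m)) \<longlonglongrightarrow> planck \<nu> t"
proof (cases "t = 0")
  case True
  have "(\<lambda>m. planck \<nu> (T m)) \<longlonglongrightarrow> 0"
  proof (rule tendsto_sandwich[where f="\<lambda>_. 0" and h="\<lambda>m. \<nu>\<^sup>2 * T m"])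
    show "(\<lambda>m. \<nu>\<^sup>2 * T m) \<longlonglongrightarrow> 0"
      using tendsto_mult_left[OF t(1), of "\<nu>\<^sup>2"] True by simp
  qed (simp_all add: planck_nonneg[OF \<nu> t(2)] planck_le[OF \<nu> t(2)])
  then show ?thesis using True by (simp add: planck_def)
next
  case False
  then have pos: "0 < t" using t by simp
  have "eventually (\<lambda>m. 0 < T m) sequentially" using order_tendstoD(1)[OF t(1) pos] .
  then have "eventually (\<lambda>m. \<nu> ^ 3 / (exp (\<nu> / T m) - 1) = planck \<nu> (T m)) sequentially"
    by eventually_elim (simp add: planck_def)
  moreover have "(\<lambda>m. \<nu> ^ 3 / (exp (\<nu> / T m) - 1)) \<longlonglongrightarrow> \<nu> ^ 3 / (exp (\<nu> / t) - 1)"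
  proof (intro tendsto_divide tendsto_diff tendsto_exp tendsto_const t(1))
    show "t \<noteq> 0" using pos by simp
    show "exp (\<nu> / t) - 1 \<noteq> 0" using pos \<nu> by simp
  qed
  ultimately have "(\<lambda>m. planck \<nu> (T m)) \<longlonglongrightarrow> \<nu> ^ 3 / (exp (\<nu> / t) - 1)"
    by (rule Lim_transform_eventually[rotated])
  then show ?thesis using False by (simp add: planck_def)
qed

lemma medium_pos:
  assumes "medium_ok D" "z \<in> alts D" "\<nu> \<in> freqs"
  shows "0 < kappa_a D z \<nu>" "0 \<le> kappa_s D z \<nu>" "0 < refr D z"
  using assms by (auto simp: medium_ok_def kappa_a_def kappa_s_def alts_def less_imp_le)

lemma planck_n_nonneg:
  assumes "0 < \<nu>" "0 \<le> t"
  shows "0 \<le> planck_n D z \<nu> t"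
  using planck_nonneg[OF assms] by (simp add: planck_n_def)

lemma planck_n_mono:
  assumes "0 < \<nu>" "0 \<le> s" "s \<le> t"
  shows "planck_n D z \<nu> s \<le> planck_n D z \<nu> t"
  using planck_strict_mono[OF assms(1,2), of t] assms(3)
  by (cases "s = t") (auto simp: planck_n_def intro!: divide_right_mono)

lemma planck_n_tendsto:
  assumes "0 < \<nu>" "T \<longlonglongrightarrow> t" "\<And>m. 0 \<le> T m" "0 \<le> t" "0 < refr D z"
  shows "(\<lambda>m::nat. planck_n D z \<nu> (T m)) \<longlonglongrightarrow> planck_n D z \<nu> t"
  unfolding planck_n_def using assms(5)
  by (intro tendsto_divide planck_tendsto assms tendsto_const) simp

lemma measurable_zero_state: "measurable_state D zero_state"
  by (simp add: measurable_state_def zero_state_def)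

context
  fixes D :: medium and z :: real
  assumes D: "medium_ok D" and z: "z \<in> alts D"
begin

lemma emitted_zero: "emitted D 0 z = (\<lambda>_. 0)"
  by (simp add: emitted_def planck_n_def planck_def fun_eq_iff)

lemma emitted_nonneg: "\<nu> \<in> freqs \<Longrightarrow> 0 \<le> t \<Longrightarrow> 0 \<le> emitted D t z \<nu>"
  using medium_pos[OF D z, of \<nu>] planck_n_nonneg[of \<nu> t D z]
  by (simp add: emitted_def freqs_def)

lemma emitted_mono: "\<nu> \<in> freqs \<Longrightarrow> 0 \<le> s \<Longrightarrow> s \<le> t \<Longrightarrow> emitted D s z \<nu> \<le> emitted D t z \<nu>"
  using medium_pos[OF D z, of \<nu>] planck_n_mono[of \<nu> s t D z]
  by (simp add: emitted_def freqs_def)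

lemma emitted_strict_mono:
  assumes "\<nu> \<in> freqs" "0 \<le> s" "s < t"
  shows "emitted D s z \<nu> < emitted D t z \<nu>"
  using medium_pos[OF D z assms(1)] planck_strict_mono[of \<nu> s t] assms
  by (simp add: emitted_def planck_n_def freqs_def divide_strict_right_mono)

lemma emitted_integrable_below:
  assumes "set_integrable lborel freqs (emitted D t z)" "0 \<le> s" "s \<le> t"
  shows "set_integrable lborel freqs (emitted D s z)"
  by (rule set_integrable_dominated[OF assms(1)
        measurable_emitted_section[OF D measurable_zero_state z]])
     (simp_all add: assms emitted_nonneg emitted_mono)

text \<open>Total emission is strictly increasing because the Planck function is, at every frequency, and
  \<open>\<kappa>\<^sub>a > 0\<close>. This gives uniqueness of the temperature, its monotone dependence on the
  absorbed energy, and also its continuity.\<close>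

lemma emission_strict_mono:
  assumes i: "set_integrable lborel freqs (emitted D t z)" and s: "0 \<le> s" "s < t"
  shows "(LBINT \<nu>:freqs. emitted D s z \<nu>) < (LBINT \<nu>:freqs. emitted D t z \<nu>)"
proof (rule ccontr)
  let ?h = "\<lambda>\<nu>. emitted D t z \<nu> - emitted D s z \<nu>"
  assume "\<not> ?thesis"
  moreover have si: "set_integrable lborel freqs (emitted D s z)"
    using emitted_integrable_below[OF i, of s] s by simp
  moreover have h: "0 \<le> indicator freqs \<nu> *\<^sub>R ?h \<nu>" for \<nu>
    using emitted_mono[of \<nu> s t] s by (auto simp: indicator_def)
  then have "0 \<le> (LBINT \<nu>:freqs. ?h \<nu>)"
    unfolding set_lebesgue_integral_def by (rule Bochner_Integration.integral_nonneg)
  ultimately have "(LBINT \<nu>:freqs. ?h \<nu>) = 0"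
    using set_integral_diff(2)[OF i si] by simp
  moreover have "integrable lborel (\<lambda>\<nu>. indicator freqs \<nu> *\<^sub>R ?h \<nu>)"
    using set_integral_diff(1)[OF i si] by (simp add: set_integrable_def)
  \<comment> \<open>Equal totals would force equal emissions at almost all frequencies.\<close>
  ultimately have "AE \<nu> in lborel. indicator freqs \<nu> *\<^sub>R ?h \<nu> = 0"
    using h by (subst (asm) set_lebesgue_integral_def, subst (asm) integral_nonneg_eq_0_iff_AE) auto
  then have "AE \<nu> in lborel. \<nu> \<notin> {0<..<1::real}"
  proof eventually_elim
    fix \<nu> :: real assume "indicator freqs \<nu> *\<^sub>R ?h \<nu> = 0"
    then show "\<nu> \<notin> {0<..<1}"
      using emitted_strict_mono[of \<nu> s t] s by (cases "\<nu> \<in> freqs") (auto simp: freqs_def)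
  qed
  then have "{0<..<1::real} \<in> null_sets lborel"
    by (subst AE_iff_null_sets) auto
  then show False by (simp add: null_sets_def)
qed

lemma emission_mono:
  assumes "set_integrable lborel freqs (emitted D t z)" "0 \<le> s" "s \<le> t"
  shows "(LBINT \<nu>:freqs. emitted D s z \<nu>) \<le> (LBINT \<nu>:freqs. emitted D t z \<nu>)"
  using emission_strict_mono[OF assms(1,2)] assms(3) by (cases "s = t") auto

lemma emission_continuous:
  assumes "set_integrable lborel freqs (emitted D t z)"
  shows "continuous_on {0..t} (\<lambda>s. LBINT \<nu>:freqs. emitted D s z \<nu>)"
  unfolding continuous_on_sequentially
proof (intro allI ballI impI, unfold comp_def)
  fix T s assume s: "s \<in> {0..t}" and T: "(\<forall>m. T m \<in> {0..t}) \<and> T \<longlonglongrightarrow> s"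
  show "(\<lambda>m. LBINT \<nu>:freqs. emitted D (T m) z \<nu>) \<longlonglongrightarrow> (LBINT \<nu>:freqs. emitted D s z \<nu>)"
  proof (rule set_integral_tendsto_dominated[OF assms])
    show "(\<lambda>m. emitted D (T m) z \<nu>) \<longlonglongrightarrow> emitted D s z \<nu>" if "\<nu> \<in> freqs" for \<nu>
      unfolding emitted_def using s T that medium_pos[OF D z that]
      by (intro tendsto_mult tendsto_const planck_n_tendsto) (simp_all add: freqs_def)
    show "set_borel_measurable lborel freqs (emitted D (T m) z)"
      "set_borel_measurable lborel freqs (emitted D s z)" for m
      by (rule measurable_emitted_section[OF D measurable_zero_state z])+
  qed (use s T in \<open>simp_all add: emitted_nonneg emitted_mono\<close>)
qed

lemma temperature_unique:
  assumes "is_temp D I z s" "is_temp D I z t"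
  shows "s = t"
proof (cases s t rule: linorder_cases)
  case less
  then show ?thesis using assms emission_strict_mono[of t s] by (simp add: is_temp_def)
next
  case greater
  then show ?thesis using assms emission_strict_mono[of s t] by (simp add: is_temp_def)
qed

text \<open>If a temperature \<open>t\<close> emits at least the energy that is absorbed, the intermediate value theorem on
  \<open>[0, t]\<close> yields the temperature in balance. In the iteration \<open>t\<close> is the temperature produced by
  a larger state.\<close>

lemma temperature_exists:
  assumes "0 \<le> t" "set_integrable lborel freqs (emitted D t z)"
    and "0 \<le> (LBINT \<nu>:freqs. absorbed D I z \<nu>)"
    and "(LBINT \<nu>:freqs. absorbed D I z \<nu>) \<le> (LBINT \<nu>:freqs. emitted D t z \<nu>)"
  obtains s where "s \<le> t" "is_temp D I z s"
proof -
  have "\<exists>s\<ge>0. s \<le> t \<and> (LBINT \<nu>:freqs. emitted D s z \<nu>) = (LBINT \<nu>:freqs. absorbed D I z \<nu>)"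
    by (rule IVT') (use assms emission_continuous[OF assms(2)] in \<open>auto simp: emitted_zero\<close>)
  then obtain s where "0 \<le> s" "s \<le> t"
    "(LBINT \<nu>:freqs. emitted D s z \<nu>) = (LBINT \<nu>:freqs. absorbed D I z \<nu>)" by blast
  then show thesis
    using emitted_integrable_below[OF assms(2)] by (intro that[of s]) (auto simp: is_temp_def)
qed

end

section \<open>Transmission and the Fresnel matrices\<close>

lemma transm_nonneg: "0 \<le> transm D c \<nu> a b"
  by (simp add: transm_def)

text \<open>Attenuation is multiplicative along a characteristic. This includes the degenerate cases: the
  left-hand side vanishes exactly if one of the factors does, because the interface is a null set and
  is exempt from the positivity condition.\<close>

lemma transm_split:
  assumes "a < z_int D" "z_int D < b"
  shows "transm D c \<nu> a b = transm D c \<nu> a (z_int D) * transm D c \<nu> (z_int D) b"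
proof -
  let ?Y = "z_int D" and ?f = "\<lambda>y. kappa D y \<nu> / c y"
  have d: "({a<..<b} - ({a<..<?Y} \<union> {?Y<..<b})) \<union> (({a<..<?Y} \<union> {?Y<..<b}) - {a<..<b}) \<subseteq> {?Y}"
    using assms by auto
  have i: "set_integrable lborel {a<..<b} ?f \<longleftrightarrow>
      set_integrable lborel {a<..<?Y} ?f \<and> set_integrable lborel {?Y<..<b} ?f"
  proof
    assume "set_integrable lborel {a<..<b} ?f"
    then show "set_integrable lborel {a<..<?Y} ?f \<and> set_integrable lborel {?Y<..<b} ?f"
      using assms by (auto intro: set_integrable_subset)
  next
    assume "set_integrable lborel {a<..<?Y} ?f \<and> set_integrable lborel {?Y<..<b} ?f"
    then have "set_integrable lborel ({a<..<?Y} \<union> {?Y<..<b}) ?f"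
      by (intro set_integrable_Un) auto
    then show "set_integrable lborel {a<..<b} ?f"
      by (subst set_integrable_discrete_difference[OF _ d]) auto
  qed
  have "(\<forall>y\<in>{a<..<b} - {?Y}. 0 < c y) \<longleftrightarrow>
      (\<forall>y\<in>{a<..<?Y} - {?Y}. 0 < c y) \<and> (\<forall>y\<in>{?Y<..<b} - {?Y}. 0 < c y)"
  proof (intro iffI conjI ballI; (elim conjE)?)
    fix y assume "\<forall>y\<in>{a<..<?Y} - {?Y}. 0 < c y" "\<forall>y\<in>{?Y<..<b} - {?Y}. 0 < c y"
      "y \<in> {a<..<b} - {?Y}"
    then show "0 < c y" by (cases "y < ?Y") auto
  qed (use assms in auto)
  moreover have "(LBINT y:{a<..<b}. ?f y) = (LBINT y:{a<..<?Y}. ?f y) + (LBINT y:{?Y<..<b}. ?f y)"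
    if "set_integrable lborel {a<..<?Y} ?f" "set_integrable lborel {?Y<..<b} ?f"
    using that
    by (subst set_integral_discrete_difference[OF _ d]) (auto intro: set_integral_Un)
  ultimately show ?thesis
    by (auto simp: transm_def i exp_add[symmetric])
qed

text \<open>Off total reflection the square root is real, so the Fresnel coefficients are nonnegative.\<close>

lemma eta_F_nonneg:
  assumes "0 < n" "0 < m" "m \<le> 1" "n \<le> 1 \<or> mu_crit n < m"
  shows "0 \<le> eta_F n m"
proof -
  have "n\<^sup>2 * (1 - m\<^sup>2) \<le> 1"
  proof (cases "n \<le> 1")
    case True
    have "m\<^sup>2 \<le> 1" using assms by (simp add: power_le_one)
    then show ?thesis
      using True assms by (intro mult_le_one) (auto simp: power_le_one)
  next
    case False
    then have "sqrt (1 - 1 / n\<^sup>2) < sqrt (m\<^sup>2)"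
      using assms by (simp add: mu_crit_def)
    then have "1 - 1 / n\<^sup>2 < m\<^sup>2" by (simp only: real_sqrt_less_iff)
    then show ?thesis using assms by (simp add: field_simps)
  qed
  then show ?thesis by (simp add: eta_F_def)
qed

lemma fresnel_nonneg:
  assumes "0 < n" "0 < m" "m \<le> 1" "0 \<le> v"
  shows "0 \<le> fresnel_X n m *v v" "0 \<le> fresnel_Y n m *v v"
  using assms eta_F_nonneg[OF assms(1-3)]
  by (auto simp: fresnel_X_mult fresnel_Y_mult nonneg_vec2)

lemma fresnel_mono:
  assumes "0 < n" "0 < m" "m \<le> 1" "u \<le> v"
  shows "fresnel_X n m *v u \<le> fresnel_X n m *v v" "fresnel_Y n m *v u \<le> fresnel_Y n m *v v"
  using fresnel_nonneg[OF assms(1-3), of "v - u"] assms(4)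
  by (simp_all add: matrix_vector_mult_diff_distrib)

section \<open>Monotonicity of the intensity update\<close>

text \<open>A beam that has crossed the interface consists of what was emitted beyond it plus the attenuated
  beam at the interface. The latter is the term which the jump subtracts.\<close>

lemma beam_up_split:
  assumes D: "medium_ok D" and z: "z_int D < z" and conv: "beam_up_conv D X c \<nu> z"
  shows "beam_up D X c \<nu> z =
    (LBINT y:{z_int D<..<z}. transm D c \<nu> y z *\<^sub>R src_along D X c \<nu> y)
    + transm D c \<nu> (z_int D) z *\<^sub>R beam_up D X c \<nu> (z_int D)"
proof -
  let ?Y = "z_int D" and ?f = "\<lambda>y. transm D c \<nu> y z *\<^sub>R src_along D X c \<nu> y"
  have Y: "0 < ?Y" using D by (simp add: medium_ok_def)
  have d: "({0<..<z} - ({0<..<?Y} \<union> {?Y<..<z})) \<union> (({0<..<?Y} \<union> {?Y<..<z}) - {0<..<z}) \<subseteq> {?Y}"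
    using Y z by auto
  have i: "set_integrable lborel {0<..<?Y} ?f" "set_integrable lborel {?Y<..<z} ?f"
    using Y z conv unfolding beam_up_conv_def by (auto intro: set_integrable_subset)
  have "(LBINT y:{0<..<z}. ?f y) = (LBINT y:{0<..<?Y}. ?f y) + (LBINT y:{?Y<..<z}. ?f y)"
    using i by (subst set_integral_discrete_difference[OF _ d]) (auto intro: set_integral_Un)
  also have "(LBINT y:{0<..<?Y}. ?f y) = (LBINT y:{0<..<?Y}. transm D c \<nu> ?Y z *\<^sub>R
      (transm D c \<nu> y ?Y *\<^sub>R src_along D X c \<nu> y))"
    using z by (intro set_lebesgue_integral_cong) (auto simp: transm_split[of _ D z])
  also have "\<dots> = transm D c \<nu> ?Y z *\<^sub>R (LBINT y:{0<..<?Y}. transm D c \<nu> y ?Y *\<^sub>R src_along D X c \<nu> y)"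
    by (rule set_integral_scaleR_right)
  finally show ?thesis
    using transm_split[OF Y z, of c \<nu>] by (simp add: beam_up_def scaleR_add_right)
qed

lemma beam_down_split:
  assumes D: "medium_ok D" and z: "z < z_int D" and conv: "beam_down_conv D X c \<nu> z"
  shows "beam_down D X c \<nu> z =
    (LBINT y:{z<..<z_int D}. transm D c \<nu> z y *\<^sub>R src_along D X c \<nu> y)
    + transm D c \<nu> z (z_int D) *\<^sub>R beam_down D X c \<nu> (z_int D)"
proof -
  let ?Y = "z_int D" and ?Z = "z_top D" and ?f = "\<lambda>y. transm D c \<nu> z y *\<^sub>R src_along D X c \<nu> y"
  have Y: "?Y < ?Z" using D by (simp add: medium_ok_def)
  have d: "({z<..<?Z} - ({z<..<?Y} \<union> {?Y<..<?Z})) \<union> (({z<..<?Y} \<union> {?Y<..<?Z}) - {z<..<?Z}) \<subseteq> {?Y}"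
    using Y z by auto
  have i: "set_integrable lborel {z<..<?Y} ?f" "set_integrable lborel {?Y<..<?Z} ?f"
    using Y z conv unfolding beam_down_conv_def by (auto intro: set_integrable_subset)
  have "(LBINT y:{z<..<?Z}. ?f y) = (LBINT y:{z<..<?Y}. ?f y) + (LBINT y:{?Y<..<?Z}. ?f y)"
    using i by (subst set_integral_discrete_difference[OF _ d]) (auto intro: set_integral_Un)
  also have "(LBINT y:{?Y<..<?Z}. ?f y) = (LBINT y:{?Y<..<?Z}. transm D c \<nu> z ?Y *\<^sub>R
      (transm D c \<nu> ?Y y *\<^sub>R src_along D X c \<nu> y))"
    using z by (intro set_lebesgue_integral_cong) (auto simp: transm_split[of z D])
  also have "\<dots> = transm D c \<nu> z ?Y *\<^sub>R (LBINT y:{?Y<..<?Z}. transm D c \<nu> ?Y y *\<^sub>R src_along D X c \<nu> y)"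
    by (rule set_integral_scaleR_right)
  finally show ?thesis
    using transm_split[OF z Y, of c \<nu>] by (simp add: beam_down_def scaleR_add_right)
qed

text \<open>The next two predicates name the first two groups of conditions in \<open>iter_defined\<close>, namely those
  on the state alone and those at one point \<open>(z, \<mu>, \<nu>)\<close>.\<close>

definition angular_integrable :: "medium \<Rightarrow> state \<Rightarrow> bool" where
  "angular_integrable D X \<longleftrightarrow>
     (\<forall>z\<in>alts D. \<forall>\<nu>\<in>freqs. set_integrable lborel {-1..1} (\<lambda>\<mu>. snd X z \<mu> \<nu>))"

definition beams_conv :: "medium \<Rightarrow> state \<Rightarrow> real \<Rightarrow> real \<Rightarrow> real \<Rightarrow> bool" where
  "beams_conv D X z \<mu> \<nu> \<longleftrightarrow>
     (let Y = z_int D; c = eta D z \<mu>;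
          cpm = eta_jump D (ratio_pm D) z \<mu>; cmp = eta_jump D (ratio_mp D) z \<mu>
      in (0 < \<mu> \<longrightarrow> beam_up_conv D X c \<nu> z) \<and>
         (\<mu> < 0 \<longrightarrow> beam_down_conv D X c \<nu> z) \<and>
         (Y < z \<and> 0 < \<mu> \<longrightarrow> beam_down_conv D X c \<nu> Y \<and> beam_up_conv D X cpm \<nu> Y \<and>
                            beam_up_conv D X c \<nu> Y) \<and>
         (z < Y \<and> \<mu> < 0 \<longrightarrow> beam_down_conv D X c \<nu> Y \<and> beam_up_conv D X c \<nu> Y \<and>
                            beam_down_conv D X cmp \<nu> Y))"

lemma iter_defined_iff:
  "iter_defined D X \<longleftrightarrow> angular_integrable D X \<and>
     (\<forall>z\<in>alts D. \<forall>\<mu>\<in>dirs. \<forall>\<nu>\<in>freqs. beams_conv D X z \<mu> \<nu>) \<and>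
     angular_integrable D (iter D X) \<and>
     (\<forall>z\<in>alts D. set_integrable lborel freqs (absorbed D (next_I D X) z) \<and>
        (\<exists>!t. is_temp D (next_I D X) z t))"
  unfolding iter_defined_def beams_conv_def angular_integrable_def iter_def snd_conv
  by blast

text \<open>The reason for monotonicity. The jump enters the update with the incoming beam subtracted, so that
  the formula as it stands is not visibly monotone in the state. After splitting the beam at the
  interface this term cancels, and what remains is a combination of sources, boundary values and
  beams with nonnegative coefficients.\<close>

lemma next_I_positive_form:
  assumes D: "medium_ok D" and conv: "beams_conv D X z \<mu> \<nu>" and \<mu>: "\<mu> \<in> dirs"
  shows "next_I D X z \<mu> \<nu> =
    (let Y = z_int D; c = eta_jump D 1 z \<mu> in
     if 0 < \<mu> then
       if z \<le> Y then beam_up D X c \<nu> z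
       else (LBINT y:{Y<..<z}. transm D c \<nu> y z *\<^sub>R src_along D X c \<nu> y)
         + transm D c \<nu> Y z *\<^sub>R (fresnel_X (ratio_pm D) \<bar>\<mu>\<bar> *v beam_down D X c \<nu> Y
           + fresnel_Y (ratio_pm D) \<bar>\<mu>\<bar> *v beam_up D X (eta_jump D (ratio_pm D) z \<mu>) \<nu> Y)
     else
       if Y \<le> z then beam_down D X c \<nu> z
       else (LBINT y:{z<..<Y}. transm D c \<nu> z y *\<^sub>R src_along D X c \<nu> y)
         + transm D c \<nu> z Y *\<^sub>R (fresnel_X (ratio_mp D) \<bar>\<mu>\<bar> *v beam_up D X c \<nu> Y
           + fresnel_Y (ratio_mp D) \<bar>\<mu>\<bar> *v beam_down D X (eta_jump D (ratio_mp D) z \<mu>) \<nu> Y))"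
proof -
  \<comment> \<open>\<open>b\<close> is the incoming beam at the interface: contained in the update and subtracted by the jump.\<close>
  have scale: "(x + a *\<^sub>R b) + a *\<^sub>R (p + q - b) = x + a *\<^sub>R (p + q)"
    "(x + a *\<^sub>R b) + (0 - a) *\<^sub>R (b - p - q) = x + a *\<^sub>R (p + q)" for x b p q :: "real^2" and a
    by (simp_all add: scaleR_diff_right scaleR_add_right)
  consider "0 < \<mu>" "z \<le> z_int D" | "0 < \<mu>" "z_int D < z" | "\<mu> < 0" "z_int D \<le> z" | "\<mu> < 0" "z < z_int D"
    using \<mu> by (force simp: dirs_def)
  then show ?thesis
  proof cases
    case 2
    then have "beam_up_conv D X (eta_jump D 1 z \<mu>) \<nu> z"
      using conv by (simp add: beams_conv_def Let_def eta_eq_eta_jump)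
    note split = beam_up_split[OF D 2(2) this]
    have "next_I D X z \<mu> \<nu> = beam_up D X (eta_jump D 1 z \<mu>) \<nu> z
        + transm D (eta_jump D 1 z \<mu>) \<nu> (z_int D) z *\<^sub>R jump D X z \<mu> \<nu>"
      using 2 by (simp add: next_I_def Let_def eta_eq_eta_jump)
    moreover have n: "\<not> z \<le> z_int D" using 2 by simp
    ultimately show ?thesis
      unfolding split jump_def Let_def eta_eq_eta_jump by (simp only: scale if_True if_False 2(1) n)
  next
    case 4
    then have "beam_down_conv D X (eta_jump D 1 z \<mu>) \<nu> z"
      using conv by (simp add: beams_conv_def Let_def eta_eq_eta_jump)
    note split = beam_down_split[OF D 4(2) this]
    have "next_I D X z \<mu> \<nu> = beam_down D X (eta_jump D 1 z \<mu>) \<nu> z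
        + (0 - transm D (eta_jump D 1 z \<mu>) \<nu> z (z_int D)) *\<^sub>R jump D X z \<mu> \<nu>"
      using 4 by (simp add: next_I_def Let_def eta_eq_eta_jump)
    moreover have "\<not> 0 < \<mu>" "\<not> z_int D \<le> z" using 4 by auto
    ultimately show ?thesis
      unfolding split jump_def Let_def eta_eq_eta_jump by (simp only: scale if_False)
  qed (simp_all add: next_I_def Let_def eta_eq_eta_jump)
qed

section \<open>Domination and dominated convergence for the intensity update\<close>

lemma state_leD:
  assumes "state_le D X W" "z \<in> alts D"
  shows "fst X z \<le> fst W z" "\<mu> \<in> dirs \<Longrightarrow> \<nu> \<in> freqs \<Longrightarrow> snd X z \<mu> \<nu> \<le> snd W z \<mu> \<nu>"
  using assms by (auto simp: state_le_def)

lemma state_nonnegD: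
  assumes "state_le D zero_state X" "z \<in> alts D"
  shows "0 \<le> fst X z" "\<mu> \<in> dirs \<Longrightarrow> \<nu> \<in> freqs \<Longrightarrow> 0 \<le> snd X z \<mu> \<nu>"
  using assms by (auto simp: state_le_def zero_state_def)

lemma angular_integrableD:
  "angular_integrable D X \<Longrightarrow> z \<in> alts D \<Longrightarrow> \<nu> \<in> freqs \<Longrightarrow>
    set_integrable lborel {-1..1} (\<lambda>\<mu>. snd X z \<mu> \<nu>)"
  by (simp add: angular_integrable_def)

lemma state_limD:
  assumes "state_lim D Xs L" "z \<in> alts D"
  shows "(\<lambda>m. fst (Xs m) z) \<longlonglongrightarrow> fst L z"
    "\<mu> \<in> dirs \<Longrightarrow> \<nu> \<in> freqs \<Longrightarrow> (\<lambda>m. snd (Xs m) z \<mu> \<nu>) \<longlonglongrightarrow> snd L z \<mu> \<nu>"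
  using assms by (auto simp: state_lim_def)

lemma weight_source:
  assumes "m \<in> {-1..1}"
  shows "weight (rayleigh m)" "weight (\<lambda>_. m\<^sup>2)" "weight (\<lambda>_. 1)" "weight power2"
proof -
  have "m\<^sup>2 \<le> 1" using assms by (auto simp: abs_square_le_1 abs_le_iff)
  then have "m\<^sup>2 \<le> 3" by simp
  then show "weight (rayleigh m)" "weight (\<lambda>_. m\<^sup>2)" "weight (\<lambda>_. 1)" "weight power2"
    using weight_rayleigh[OF assms] weight_square weight_const[of "m\<^sup>2"] weight_const[of 1] by simp_all
qed

text \<open>Together with the positivity of moments and the monotonicity of the Planck function, these signs
  make the source a monotone function of the state.\<close>

lemma source_coefficients:
  assumes "medium_ok D" "z \<in> alts D" "\<nu> \<in> freqs"
  shows "0 \<le> 3 * ray D * kappa_s D z \<nu> / 8" "0 \<le> (1 - ray D) * kappa_s D z \<nu> / 4"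
    "0 \<le> kappa_a D z \<nu> / 2"
  using assms medium_pos[OF assms] by (auto simp: medium_ok_def)

lemma source_nonneg:
  assumes D: "medium_ok D" and y: "y \<in> alts D" and n: "\<nu> \<in> freqs" and m: "m \<in> {-1..1}"
    and X: "state_le D zero_state X"
  shows "0 \<le> source D X y m \<nu>"
proof -
  have "0 \<le> planck_n D y \<nu> (fst X y)"
    using n state_nonnegD(1)[OF X y] by (intro planck_n_nonneg) (auto simp: freqs_def)
  moreover have "0 \<le> moment p q (\<lambda>\<mu>. snd X y \<mu> \<nu>)" if "weight p" "weight q" for p q
    using state_nonnegD(2)[OF X y _ n] that by (intro moment_nonneg)
  ultimately show ?thesis
    unfolding source_moments nonneg_vec2 vector_2
    using weight_source[OF m] source_coefficients[OF D y n]
    by (intro conjI add_nonneg_nonneg mult_nonneg_nonneg) simp_all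
qed

lemma source_mono:
  assumes D: "medium_ok D" and y: "y \<in> alts D" and n: "\<nu> \<in> freqs" and m: "m \<in> {-1..1}"
    and X: "state_le D zero_state X" and XW: "state_le D X W"
    and i: "angular_integrable D X" "angular_integrable D W"
  shows "source D X y m \<nu> \<le> source D W y m \<nu>"
proof -
  have "planck_n D y \<nu> (fst X y) \<le> planck_n D y \<nu> (fst W y)"
    using n state_nonnegD(1)[OF X y] state_leD(1)[OF XW y]
    by (intro planck_n_mono) (auto simp: freqs_def)
  moreover have "moment p q (\<lambda>\<mu>. snd X y \<mu> \<nu>) \<le> moment p q (\<lambda>\<mu>. snd W y \<mu> \<nu>)"
    if "weight p" "weight q" for p q
    using state_leD(2)[OF XW y _ n] that angular_integrableD[OF i(1) y n] angular_integrableD[OF i(2) y n]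
    by (intro moment_mono)
  ultimately show ?thesis
    unfolding source_moments le_vec2 vector_2
    using weight_source[OF m] source_coefficients[OF D y n]
    by (intro conjI add_mono mult_left_mono) simp_all
qed

lemma source_tendsto:
  assumes D: "medium_ok D" and y: "y \<in> alts D" and n: "\<nu> \<in> freqs" and m: "m \<in> {-1..1}"
    and X: "\<And>k. state_le D zero_state (Xs k)" "\<And>k. state_le D (Xs k) W" "state_le D zero_state L"
    and i: "\<And>k. angular_integrable D (Xs k)" "angular_integrable D W" "angular_integrable D L"
    and l: "state_lim D Xs L"
  shows "(\<lambda>k. source D (Xs k) y m \<nu>) \<longlonglongrightarrow> source D L y m \<nu>"
proof -
  have "(\<lambda>k. planck_n D y \<nu> (fst (Xs k) y)) \<longlonglongrightarrow> planck_n D y \<nu> (fst L y)"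
    using n state_nonnegD(1)[OF X(1) y] state_nonnegD(1)[OF X(3) y] medium_pos[OF D y n]
    by (intro planck_n_tendsto state_limD(1)[OF l y]) (auto simp: freqs_def)
  moreover have "(\<lambda>k. moment p q (\<lambda>\<mu>. snd (Xs k) y \<mu> \<nu>)) \<longlonglongrightarrow> moment p q (\<lambda>\<mu>. snd L y \<mu> \<nu>)"
    if "weight p" "weight q" for p q
    using that state_nonnegD(2)[OF X(1) y _ n] state_leD(2)[OF X(2) y _ n] state_limD(2)[OF l y _ n]
    by (intro moment_tendsto[OF angular_integrableD[OF i(2) y n] angular_integrableD[OF i(1) y n]
          angular_integrableD[OF i(3) y n]])
  ultimately show ?thesis
    unfolding source_moments using weight_source[OF m]
    by (intro tendsto_vec2I tendsto_add tendsto_mult tendsto_const)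
qed

lemma src_along_nonneg:
  assumes "medium_ok D" "y \<in> alts D" "\<nu> \<in> freqs" "\<mu> \<in> {-1..1}" "state_le D zero_state X"
  shows "0 \<le> src_along D X (eta_jump D r z \<mu>) \<nu> y"
  using assms eta_jump_bounds[OF assms(4), of D r z y]
  by (auto simp: src_along_def intro!: scaleR_nonneg_nonneg source_nonneg)

lemma inflow_along_nonneg:
  assumes "medium_ok D" "\<nu> \<in> freqs" "\<mu> \<in> {-1..1}"
  shows "0 \<le> inflow0_along D (eta_jump D r z \<mu>) \<nu>" "0 \<le> inflowZ_along D (eta_jump D r z \<mu>) \<nu>"
  using assms eta_jump_bounds[OF assms(3), of D r z]
  by (auto simp: inflow0_along_def inflowZ_along_def medium_ok_def)

lemma interval_alts:
  "h \<in> alts D \<Longrightarrow> {0<..<h} \<subseteq> alts D" "h \<in> alts D \<Longrightarrow> {h<..<z_top D} \<subseteq> alts D"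
  "g \<in> alts D \<Longrightarrow> h \<in> alts D \<Longrightarrow> {g<..<h} \<subseteq> alts D"
  by (auto simp: alts_def)

lemma ratio_pos: "medium_ok D \<Longrightarrow> 0 < ratio_pm D" "medium_ok D \<Longrightarrow> 0 < ratio_mp D"
  by (auto simp: medium_ok_def ratio_pm_def ratio_mp_def)

text \<open>The shape of the update beyond the interface: own emission plus the attenuated sum of the
  reflected and the refracted beam.\<close>

lemma fresnel_glue_nonneg:
  assumes "0 < n" "0 < m" "m \<le> 1" "0 \<le> t" "0 \<le> x" "0 \<le> b" "0 \<le> e"
  shows "0 \<le> x + t *\<^sub>R (fresnel_X n m *v b + fresnel_Y n m *v e)"
  using assms by (intro add_nonneg_nonneg scaleR_nonneg_nonneg fresnel_nonneg)

lemma fresnel_glue_mono: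
  assumes "0 < n" "0 < m" "m \<le> 1" "0 \<le> t" "x \<le> x'" "b \<le> b'" "e \<le> e'"
  shows "x + t *\<^sub>R (fresnel_X n m *v b + fresnel_Y n m *v e)
    \<le> x' + t *\<^sub>R (fresnel_X n m *v b' + fresnel_Y n m *v e')"
  using assms by (intro add_mono scaleR_left_mono fresnel_mono)

text \<open>A measurable state between 0 and a state \<open>W\<close> for which the integrals converge. All integrands
  built from \<open>X\<close> lie between 0 and those built from \<open>W\<close>, so convergence is inherited, the updates
  are ordered, and dominated convergence applies to sequences below \<open>W\<close>.\<close>

locale dominated =
  fixes D :: medium and X W :: state
  assumes medium: "medium_ok D" and meas: "measurable_state D X"
    and nonneg: "state_le D zero_state X" and below: "state_le D X W"
    and int_W: "angular_integrable D W"
begin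

lemma int_X: "angular_integrable D X"
  unfolding angular_integrable_def set_integrable_dirs
proof (intro ballI)
  fix z \<nu> assume z: "z \<in> alts D" and n: "\<nu> \<in> freqs"
  show "set_integrable lborel dirs (\<lambda>\<mu>. snd X z \<mu> \<nu>)"
  proof (rule set_integrable_dominated)
    show "set_integrable lborel dirs (\<lambda>\<mu>. snd W z \<mu> \<nu>)"
      using angular_integrableD[OF int_W z n] by (simp add: set_integrable_dirs)
    show "set_borel_measurable lborel dirs (\<lambda>\<mu>. snd X z \<mu> \<nu>)"
      by (rule set_borel_measurable_subset[OF measurable_intensity_section[OF medium meas z n]])
         (auto simp: dirs_def)
  qed (use state_nonnegD(2)[OF nonneg z _ n] state_leD(2)[OF below z _ n] in auto)
qed

lemma src_along_le:
  assumes "y \<in> alts D" "\<nu> \<in> freqs" "\<mu> \<in> {-1..1}"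
  shows "src_along D X (eta_jump D r z \<mu>) \<nu> y \<le> src_along D W (eta_jump D r z \<mu>) \<nu> y"
  using assms eta_jump_bounds[OF assms(3), of D r z y]
  by (auto simp: src_along_def intro!: scaleR_left_mono source_mono[OF medium] nonneg below int_X int_W)

context
  fixes z \<mu> \<nu> :: real
  assumes z: "z \<in> alts D" and mu: "\<mu> \<in> {-1..1}" and nu: "\<nu> \<in> freqs"
begin

lemma integrand_nonneg:
  "y \<in> alts D \<Longrightarrow> 0 \<le> transm D (eta_jump D r z \<mu>) \<nu> a b *\<^sub>R src_along D X (eta_jump D r z \<mu>) \<nu> y"
  by (intro scaleR_nonneg_nonneg transm_nonneg src_along_nonneg medium mu nu nonneg)

lemma integrand_le:
  "y \<in> alts D \<Longrightarrow> transm D (eta_jump D r z \<mu>) \<nu> a b *\<^sub>R src_along D X (eta_jump D r z \<mu>) \<nu> y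
     \<le> transm D (eta_jump D r z \<mu>) \<nu> a b *\<^sub>R src_along D W (eta_jump D r z \<mu>) \<nu> y"
  by (intro scaleR_left_mono transm_nonneg src_along_le mu nu)

lemma beam_up_conv_dominated:
  assumes h: "h \<in> alts D" and W: "beam_up_conv D W (eta_jump D r z \<mu>) \<nu> h"
  shows "beam_up_conv D X (eta_jump D r z \<mu>) \<nu> h"
  using W unfolding beam_up_conv_def
proof (rule set_integrable_dominated)
  show "set_borel_measurable lborel {0<..<h}
      (\<lambda>y. transm D (eta_jump D r z \<mu>) \<nu> y h *\<^sub>R src_along D X (eta_jump D r z \<mu>) \<nu> y)"
    using h by (intro measurable_up_integrand[OF medium meas z nu mu]) (auto simp: alts_def)
qed (use interval_alts(1)[OF h] in \<open>auto intro: integrand_nonneg integrand_le\<close>)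

lemma beam_down_conv_dominated:
  assumes h: "h \<in> alts D" and W: "beam_down_conv D W (eta_jump D r z \<mu>) \<nu> h"
  shows "beam_down_conv D X (eta_jump D r z \<mu>) \<nu> h"
  using W unfolding beam_down_conv_def
proof (rule set_integrable_dominated)
  show "set_borel_measurable lborel {h<..<z_top D}
      (\<lambda>y. transm D (eta_jump D r z \<mu>) \<nu> h y *\<^sub>R src_along D X (eta_jump D r z \<mu>) \<nu> y)"
    using h by (intro measurable_down_integrand[OF medium meas z nu mu]) (auto simp: alts_def)
qed (use interval_alts(2)[OF h] in \<open>auto intro: integrand_nonneg integrand_le\<close>)

lemma beam_nonneg:
  assumes h: "h \<in> alts D"
  shows "0 \<le> beam_up D X (eta_jump D r z \<mu>) \<nu> h" "0 \<le> beam_down D X (eta_jump D r z \<mu>) \<nu> h"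
  unfolding beam_up_def beam_down_def using interval_alts(1,2)[OF h]
  by (intro add_nonneg_nonneg scaleR_nonneg_nonneg transm_nonneg inflow_along_nonneg medium mu nu
      set_integral_nonneg_vec integrand_nonneg; auto)+

lemma beam_up_le:
  assumes h: "h \<in> alts D" and W: "beam_up_conv D W (eta_jump D r z \<mu>) \<nu> h"
  shows "beam_up D X (eta_jump D r z \<mu>) \<nu> h \<le> beam_up D W (eta_jump D r z \<mu>) \<nu> h"
  using W beam_up_conv_dominated[OF h W] interval_alts(1)[OF h]
  unfolding beam_up_def beam_up_conv_def
  by (intro add_left_mono set_integral_mono_vec integrand_le) auto

lemma beam_down_le:
  assumes h: "h \<in> alts D" and W: "beam_down_conv D W (eta_jump D r z \<mu>) \<nu> h"
  shows "beam_down D X (eta_jump D r z \<mu>) \<nu> h \<le> beam_down D W (eta_jump D r z \<mu>) \<nu> h"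
  using W beam_down_conv_dominated[OF h W] interval_alts(2)[OF h]
  unfolding beam_down_def beam_down_conv_def
  by (intro add_left_mono set_integral_mono_vec integrand_le) auto

lemma beams_conv_dominated:
  assumes "beams_conv D W z \<mu> \<nu>"
  shows "beams_conv D X z \<mu> \<nu>"
  using assms z z_int_alts[OF medium]
  unfolding beams_conv_def Let_def eta_eq_eta_jump
  by (simp add: beam_up_conv_dominated beam_down_conv_dominated)

lemma next_I_nonneg:
  assumes conv: "beams_conv D W z \<mu> \<nu>" and m: "\<mu> \<in> dirs"
  shows "0 \<le> next_I D X z \<mu> \<nu>"
proof -
  have Y: "z_int D \<in> alts D" by (rule z_int_alts[OF medium])
  have a: "0 < \<bar>\<mu>\<bar>" "\<bar>\<mu>\<bar> \<le> 1" using m by (auto simp: dirs_def)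
  note sub = interval_alts(3)[OF Y z] interval_alts(3)[OF z Y]
  note ratio = ratio_pos[OF medium]
  note form = next_I_positive_form[OF medium beams_conv_dominated[OF conv] m]
  have int: "0 \<le> (LBINT y:{z_int D<..<z}. transm D (eta_jump D 1 z \<mu>) \<nu> y z *\<^sub>R src_along D X (eta_jump D 1 z \<mu>) \<nu> y)"
    "0 \<le> (LBINT y:{z<..<z_int D}. transm D (eta_jump D 1 z \<mu>) \<nu> z y *\<^sub>R src_along D X (eta_jump D 1 z \<mu>) \<nu> y)"
    using sub by (auto intro!: set_integral_nonneg_vec integrand_nonneg)
  consider "0 < \<mu>" "z \<le> z_int D" | "0 < \<mu>" "\<not> z \<le> z_int D"
    | "\<not> 0 < \<mu>" "z_int D \<le> z" | "\<not> 0 < \<mu>" "\<not> z_int D \<le> z"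
    by blast
  then show ?thesis
  proof cases
    case 2
    then show ?thesis unfolding form Let_def
      by (simp only: if_True if_False)
         (intro fresnel_glue_nonneg ratio a transm_nonneg int beam_nonneg Y)
  next
    case 4
    then show ?thesis unfolding form Let_def
      by (simp only: if_True if_False)
         (intro fresnel_glue_nonneg ratio a transm_nonneg int beam_nonneg Y)
  qed (simp_all add: form Let_def beam_nonneg z)
qed

lemma next_I_le:
  assumes conv: "beams_conv D W z \<mu> \<nu>" and m: "\<mu> \<in> dirs"
  shows "next_I D X z \<mu> \<nu> \<le> next_I D W z \<mu> \<nu>"
proof -
  have Y: "z_int D \<in> alts D" by (rule z_int_alts[OF medium])
  have a: "0 < \<bar>\<mu>\<bar>" "\<bar>\<mu>\<bar> \<le> 1" using m by (auto simp: dirs_def)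
  note ratio = ratio_pos[OF medium]
  note conv' = beams_conv_dominated[OF conv]
  note forms = next_I_positive_form[OF medium conv m] next_I_positive_form[OF medium conv' m]
  let ?c = "eta_jump D 1 z \<mu>"
  have up: "(LBINT y:{z_int D<..<z}. transm D ?c \<nu> y z *\<^sub>R src_along D X ?c \<nu> y)
      \<le> (LBINT y:{z_int D<..<z}. transm D ?c \<nu> y z *\<^sub>R src_along D W ?c \<nu> y)"
    if "0 < \<mu>" "z_int D < z"
    using conv conv' that interval_alts(3)[OF Y z] medium
    unfolding beams_conv_def Let_def eta_eq_eta_jump beam_up_conv_def
    by (intro set_integral_mono_vec integrand_le)
       (auto simp: medium_ok_def intro: set_integrable_subset)
  have down: "(LBINT y:{z<..<z_int D}. transm D ?c \<nu> z y *\<^sub>R src_along D X ?c \<nu> y)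
      \<le> (LBINT y:{z<..<z_int D}. transm D ?c \<nu> z y *\<^sub>R src_along D W ?c \<nu> y)"
    if "\<mu> < 0" "z < z_int D"
    using conv conv' that interval_alts(3)[OF z Y] medium
    unfolding beams_conv_def Let_def eta_eq_eta_jump beam_down_conv_def
    by (intro set_integral_mono_vec integrand_le)
       (auto simp: medium_ok_def intro: set_integrable_subset)
  consider "0 < \<mu>" "z \<le> z_int D" | "0 < \<mu>" "\<not> z \<le> z_int D"
    | "\<not> 0 < \<mu>" "\<mu> < 0" "z_int D \<le> z" | "\<not> 0 < \<mu>" "\<mu> < 0" "\<not> z_int D \<le> z"
    using m by (force simp: dirs_def)
  then show ?thesis
  proof cases
    case 1
    then show ?thesis
      using conv by (simp add: forms Let_def beams_conv_def eta_eq_eta_jump beam_up_le z)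
  next
    case 2
    then have "beam_down_conv D W ?c \<nu> (z_int D)"
      "beam_up_conv D W (eta_jump D (ratio_pm D) z \<mu>) \<nu> (z_int D)"
      using conv by (simp_all add: beams_conv_def Let_def eta_eq_eta_jump)
    with 2 show ?thesis unfolding forms Let_def
      by (simp only: if_True if_False)
         (intro fresnel_glue_mono ratio a transm_nonneg up beam_up_le beam_down_le Y; simp)
  next
    case 3
    then show ?thesis
      using conv by (simp add: forms Let_def beams_conv_def eta_eq_eta_jump beam_down_le z)
  next
    case 4
    then have "beam_up_conv D W ?c \<nu> (z_int D)"
      "beam_down_conv D W (eta_jump D (ratio_mp D) z \<mu>) \<nu> (z_int D)"
      using conv by (simp_all add: beams_conv_def Let_def eta_eq_eta_jump)
    with 4 show ?thesis unfolding forms Let_def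
      by (simp only: if_True if_False)
         (intro fresnel_glue_mono ratio a transm_nonneg down beam_up_le beam_down_le Y; simp)
  qed
qed

end

end

text \<open>For a sequence of states below \<open>W\<close>, the integrand of the beam of \<open>W\<close> is the dominating function
  for the integral along the ray; the intensity of \<open>W\<close> is the one for the angular integrals.\<close>

lemma
  assumes dom: "\<And>k. dominated D (Xs k) W" "dominated D L W" and l: "state_lim D Xs L"
    and z: "z \<in> alts D" and mu: "\<mu> \<in> {-1..1}" and nu: "\<nu> \<in> freqs" and h: "h \<in> alts D"
  shows beam_up_tendsto: "beam_up_conv D W (eta_jump D r z \<mu>) \<nu> h \<Longrightarrow>
      (\<lambda>k. beam_up D (Xs k) (eta_jump D r z \<mu>) \<nu> h) \<longlonglongrightarrow> beam_up D L (eta_jump D r z \<mu>) \<nu> h"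
    and beam_down_tendsto: "beam_down_conv D W (eta_jump D r z \<mu>) \<nu> h \<Longrightarrow>
      (\<lambda>k. beam_down D (Xs k) (eta_jump D r z \<mu>) \<nu> h) \<longlonglongrightarrow> beam_down D L (eta_jump D r z \<mu>) \<nu> h"
proof -
  interpret L: dominated D L W by fact
  interpret X: dominated D "Xs k" W for k by (rule dom)
  have s: "(\<lambda>k. src_along D (Xs k) (eta_jump D r z \<mu>) \<nu> y) \<longlonglongrightarrow> src_along D L (eta_jump D r z \<mu>) \<nu> y"
    if y: "y \<in> alts D" for y
  proof (cases "0 < eta_jump D r z \<mu> y")
    case True
    have "eta_jump D r z \<mu> y \<in> {-1..1}"
      using eta_jump_bounds[OF mu, of D r z y] by auto
    then have "(\<lambda>k. source D (Xs k) y (eta_jump D r z \<mu> y) \<nu>) \<longlonglongrightarrow> source D L y (eta_jump D r z \<mu> y) \<nu>"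
      by (intro source_tendsto[OF L.medium y nu, where W=W] X.nonneg X.below L.nonneg X.int_X L.int_W L.int_X l)
    then show ?thesis
      using True by (auto simp: src_along_def intro: tendsto_scaleR)
  qed (simp add: src_along_def)
  show "(\<lambda>k. beam_up D (Xs k) (eta_jump D r z \<mu>) \<nu> h) \<longlonglongrightarrow> beam_up D L (eta_jump D r z \<mu>) \<nu> h"
    if W: "beam_up_conv D W (eta_jump D r z \<mu>) \<nu> h"
    unfolding beam_up_def
  proof (intro tendsto_add tendsto_const set_integral_tendsto_dominated[OF W[unfolded beam_up_conv_def]])
    show "set_borel_measurable lborel {0<..<h}
        (\<lambda>y. transm D (eta_jump D r z \<mu>) \<nu> y h *\<^sub>R src_along D (Xs k) (eta_jump D r z \<mu>) \<nu> y)"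
      "set_borel_measurable lborel {0<..<h}
        (\<lambda>y. transm D (eta_jump D r z \<mu>) \<nu> y h *\<^sub>R src_along D L (eta_jump D r z \<mu>) \<nu> y)" for k
      using h by (intro measurable_up_integrand[OF L.medium _ z nu mu] X.meas L.meas; auto simp: alts_def)+
  qed (use interval_alts(1)[OF h] in \<open>auto intro: X.integrand_nonneg[OF z mu nu]
        X.integrand_le[OF z mu nu] tendsto_scaleR[OF tendsto_const s]\<close>)
  show "(\<lambda>k. beam_down D (Xs k) (eta_jump D r z \<mu>) \<nu> h) \<longlonglongrightarrow> beam_down D L (eta_jump D r z \<mu>) \<nu> h"
    if W: "beam_down_conv D W (eta_jump D r z \<mu>) \<nu> h"
    unfolding beam_down_def
  proof (intro tendsto_add tendsto_const set_integral_tendsto_dominated[OF W[unfolded beam_down_conv_def]])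
    show "set_borel_measurable lborel {h<..<z_top D}
        (\<lambda>y. transm D (eta_jump D r z \<mu>) \<nu> h y *\<^sub>R src_along D (Xs k) (eta_jump D r z \<mu>) \<nu> y)"
      "set_borel_measurable lborel {h<..<z_top D}
        (\<lambda>y. transm D (eta_jump D r z \<mu>) \<nu> h y *\<^sub>R src_along D L (eta_jump D r z \<mu>) \<nu> y)" for k
      using h by (intro measurable_down_integrand[OF L.medium _ z nu mu] X.meas L.meas; auto simp: alts_def)+
  qed (use interval_alts(2)[OF h] in \<open>auto intro: X.integrand_nonneg[OF z mu nu]
        X.integrand_le[OF z mu nu] tendsto_scaleR[OF tendsto_const s]\<close>)
qed

lemma next_I_tendsto:
  assumes dom: "\<And>k. dominated D (Xs k) W" "dominated D L W" and l: "state_lim D Xs L"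
    and z: "z \<in> alts D" and m: "\<mu> \<in> dirs" and nu: "\<nu> \<in> freqs" and conv: "beams_conv D W z \<mu> \<nu>"
  shows "(\<lambda>k. next_I D (Xs k) z \<mu> \<nu>) \<longlonglongrightarrow> next_I D L z \<mu> \<nu>"
proof -
  have D: "medium_ok D" using dom(2) by (simp add: dominated_def)
  have mu: "\<mu> \<in> {-1..1}" using m by (auto simp: dirs_def)
  have Y: "z_int D \<in> alts D" by (rule z_int_alts[OF D])
  note up = beam_up_tendsto[OF dom l z mu nu] and down = beam_down_tendsto[OF dom l z mu nu]
  have mult: "(\<lambda>k. A *v f k) \<longlonglongrightarrow> A *v a" if "f \<longlonglongrightarrow> a"
    for A :: "real^2^2" and f :: "nat \<Rightarrow> real^2" and a
    by (rule bounded_linear.tendsto[OF matrix_vector_mul_bounded_linear that])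
  have j: "(\<lambda>k. jump D (Xs k) z \<mu> \<nu>) \<longlonglongrightarrow> jump D L z \<mu> \<nu>" if "z_int D < z \<and> 0 < \<mu> \<or> z < z_int D \<and> \<mu> < 0"
    using that conv unfolding jump_def Let_def eta_eq_eta_jump beams_conv_def
    by (auto intro!: tendsto_add tendsto_diff mult up down Y)
  have "(\<lambda>k. if 0 < \<mu> then beam_up D (Xs k) (eta_jump D 1 z \<mu>) \<nu> z else 0)
      \<longlonglongrightarrow> (if 0 < \<mu> then beam_up D L (eta_jump D 1 z \<mu>) \<nu> z else 0)"
    "(\<lambda>k. if \<mu> < 0 then beam_down D (Xs k) (eta_jump D 1 z \<mu>) \<nu> z else 0)
      \<longlonglongrightarrow> (if \<mu> < 0 then beam_down D L (eta_jump D 1 z \<mu>) \<nu> z else 0)"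
    using conv unfolding Let_def eta_eq_eta_jump beams_conv_def by (auto intro!: up down z)
  moreover have "(\<lambda>k. a *\<^sub>R jump D (Xs k) z \<mu> \<nu>) \<longlonglongrightarrow> a *\<^sub>R jump D L z \<mu> \<nu>"
    if "a \<noteq> 0 \<Longrightarrow> z_int D < z \<and> 0 < \<mu> \<or> z < z_int D \<and> \<mu> < 0" for a
    using that j by (cases "a = 0") (auto intro: tendsto_scaleR)
  ultimately show ?thesis
    unfolding next_I_def Let_def eta_eq_eta_jump by (intro tendsto_add) (auto split: if_splits)
qed

section \<open>The iteration map\<close>

lemma iter_simps [simp]: "fst (iter D X) = next_T D X" "snd (iter D X) = next_I D X"
  by (simp_all add: iter_def)

lemma is_temp_next_T:
  assumes "iter_defined D X" "z \<in> alts D"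
  shows "is_temp D (next_I D X) z (next_T D X z)"
  unfolding next_T_def by (rule theI') (use assms in \<open>simp add: iter_defined_iff\<close>)

lemma absorbed_moment:
  "absorbed D I z \<nu> = kappa_a D z \<nu> / 2 * moment (\<lambda>_. 1) (\<lambda>_. 1) (\<lambda>\<mu>. I z \<mu> \<nu>)"
  by (simp add: absorbed_def moment_def)

lemma weight_one: "weight (\<lambda>_. 1)"
  by (rule weight_const) auto

text \<open>The new temperature is characterized by a comparison of measurable functions of the altitude. The
  emission is taken as a nonnegative integral because it may be infinite at temperatures above the
  actual one.\<close>

lemma next_T_le_iff:
  assumes D: "medium_ok D" and X: "iter_defined D X" and z: "z \<in> alts D"
  shows "next_T D X z \<le> t \<longleftrightarrow> 0 \<le> t \<and>
    ennreal (LBINT \<nu>:freqs. absorbed D (next_I D X) z \<nu>) \<le>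
      (\<integral>\<^sup>+ \<nu>. ennreal (indicator freqs \<nu> *\<^sub>R emitted D t z \<nu>) \<partial>lborel)"
proof -
  let ?T = "next_T D X z"
  have T: "0 \<le> ?T" "set_integrable lborel freqs (emitted D ?T z)"
    "(LBINT \<nu>:freqs. absorbed D (next_I D X) z \<nu>) = (LBINT \<nu>:freqs. emitted D ?T z \<nu>)"
    using is_temp_next_T[OF X z] by (auto simp: is_temp_def)
  have nn: "(\<integral>\<^sup>+ \<nu>. ennreal (indicator freqs \<nu> *\<^sub>R emitted D s z \<nu>) \<partial>lborel)
      = ennreal (LBINT \<nu>:freqs. emitted D s z \<nu>)"
    if "set_integrable lborel freqs (emitted D s z)" "0 \<le> s" for s
    unfolding set_lebesgue_integral_def
  proof (rule nn_integral_eq_integral)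
    show "integrable lborel (\<lambda>\<nu>. indicator freqs \<nu> *\<^sub>R emitted D s z \<nu>)"
      using that(1) by (simp add: set_integrable_def)
    show "AE \<nu> in lborel. 0 \<le> indicator freqs \<nu> *\<^sub>R emitted D s z \<nu>"
      using emitted_nonneg[OF D z _ that(2)] by (intro AE_I2) (simp add: indicator_def)
  qed
  show ?thesis
  proof (cases "0 \<le> t \<and> t < ?T")
    case True
    then have i: "set_integrable lborel freqs (emitted D t z)"
      using emitted_integrable_below[OF D z T(2)] by simp
    have "0 \<le> (LBINT \<nu>:freqs. emitted D t z \<nu>)"
      using True by (intro set_integral_nonneg_vec emitted_nonneg[OF D z]) auto
    moreover have "(LBINT \<nu>:freqs. emitted D t z \<nu>) < (LBINT \<nu>:freqs. emitted D ?T z \<nu>)"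
      using True by (intro emission_strict_mono[OF D z T(2)]) auto
    ultimately show ?thesis
      unfolding nn[OF i conjunct1[OF True]] T(3) using True by (simp add: ennreal_le_iff)
  next
    case False
    have "(\<integral>\<^sup>+ \<nu>. ennreal (indicator freqs \<nu> *\<^sub>R emitted D ?T z \<nu>) \<partial>lborel)
        \<le> (\<integral>\<^sup>+ \<nu>. ennreal (indicator freqs \<nu> *\<^sub>R emitted D t z \<nu>) \<partial>lborel)" if "?T \<le> t"
      using that T(1)
      by (intro nn_integral_mono ennreal_leI) (auto simp: indicator_def emitted_mono[OF D z])
    moreover have "?T \<le> t \<longleftrightarrow> 0 \<le> t" using False T(1) by linarith
    ultimately show ?thesis unfolding nn[OF T(2,1)] T(3) by blast
  qed
qed

text \<open>By the comparison above, the sublevel sets of the new temperature are Borel although that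
  temperature is obtained from a description operator.\<close>

lemma measurable_iter:
  assumes D: "medium_ok D" and meas: "measurable_state D X" and X: "iter_defined D X"
  shows "measurable_state D (iter D X)"
  unfolding measurable_state_def iter_simps
proof
  interpret borel_data "cut_medium D" "cut_state D X" by (rule borel_data_cut[OF D meas])
  let ?D = "cut_medium D" and ?X = "cut_state D X"
  define a where "a z = (LBINT \<nu>:freqs. absorbed ?D (next_I ?D ?X) z \<nu>)" for z
  define e where "e t z = (\<integral>\<^sup>+ \<nu>. ennreal (indicator freqs \<nu> *\<^sub>R emitted ?D t z \<nu>) \<partial>lborel)" for t z
  have [measurable]: "a \<in> borel_measurable borel"
    unfolding a_def[abs_def] set_lebesgue_integral_def by measurable
  have [measurable]: "e t \<in> borel_measurable borel" for t
    unfolding e_def[abs_def] by measurable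
  show "next_T D X \<in> borel_measurable (restrict_space borel (alts D))"
    unfolding borel_measurable_iff_le
  proof
    fix t :: real
    have "{z \<in> space (restrict_space borel (alts D)). next_T D X z \<le> t}
        = {z \<in> alts D. 0 \<le> t \<and> ennreal (a z) \<le> e t z}"
    proof (intro Collect_cong)
      fix z
      have "a z = (LBINT \<nu>:freqs. absorbed D (next_I D X) z \<nu>)" if "z \<in> alts D"
        unfolding a_def using that by (intro set_lebesgue_integral_cong) (auto simp: absorbed_cut[OF D])
      moreover have "e t z = (\<integral>\<^sup>+ \<nu>. ennreal (indicator freqs \<nu> *\<^sub>R emitted D t z \<nu>) \<partial>lborel)"
        if "z \<in> alts D"
        unfolding e_def using that by (intro nn_integral_cong) (auto simp: indicator_def emitted_cut)
      ultimately show "z \<in> space (restrict_space borel (alts D)) \<and> next_T D X z \<le> t \<longleftrightarrow>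
          z \<in> alts D \<and> 0 \<le> t \<and> ennreal (a z) \<le> e t z"
        by (cases "z \<in> alts D") (simp_all add: space_restrict_space next_T_le_iff[OF D X])
    qed
    also have "\<dots> \<in> sets borel" by measurable
    finally show "{z \<in> space (restrict_space borel (alts D)). next_T D X z \<le> t}
        \<in> sets (restrict_space borel (alts D))"
      by (simp add: sets_restrict_space_iff space_restrict_space)
  qed
  show "(\<lambda>(z, \<mu>, \<nu>). next_I D X z \<mu> \<nu>) \<in> borel_measurable (restrict_space borel (alts D \<times> dirs \<times> freqs))"
    by (rule measurable_next_I_domain[OF D meas])
qed

lemma iter_definedD:
  assumes "iter_defined D W"
  shows "angular_integrable D W"
    and "z \<in> alts D \<Longrightarrow> \<mu> \<in> dirs \<Longrightarrow> \<nu> \<in> freqs \<Longrightarrow> beams_conv D W z \<mu> \<nu>"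
    and "z \<in> alts D \<Longrightarrow> \<nu> \<in> freqs \<Longrightarrow> set_integrable lborel {-1..1} (\<lambda>\<mu>. next_I D W z \<mu> \<nu>)"
    and "z \<in> alts D \<Longrightarrow> set_integrable lborel freqs (absorbed D (next_I D W) z)"
  using assms by (simp_all add: iter_defined_iff angular_integrable_def)

text \<open>If the iteration is defined at \<open>W\<close>, it is defined at every measurable state between 0 and \<open>W\<close>,
  and monotone there. In particular, convergence of the integrals at an iterate never has to be
  assumed: it follows from convergence at one larger state.\<close>

locale dominated_iter = dominated +
  assumes defined_W: "iter_defined D W"
begin

lemma next_I_bounds:
  assumes "z \<in> alts D" "\<mu> \<in> dirs" "\<nu> \<in> freqs"
  shows "0 \<le> next_I D X z \<mu> \<nu>" "next_I D X z \<mu> \<nu> \<le> next_I D W z \<mu> \<nu>"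
  using assms iter_definedD(2)[OF defined_W assms]
  by (auto simp: dirs_def intro!: next_I_nonneg next_I_le)

lemma next_I_integrable:
  assumes z: "z \<in> alts D" and n: "\<nu> \<in> freqs"
  shows "set_integrable lborel {-1..1} (\<lambda>\<mu>. next_I D X z \<mu> \<nu>)"
  unfolding set_integrable_dirs
proof (rule set_integrable_dominated)
  show "set_integrable lborel dirs (\<lambda>\<mu>. next_I D W z \<mu> \<nu>)"
    using iter_definedD(3)[OF defined_W z n] by (simp add: set_integrable_dirs)
  show "set_borel_measurable lborel dirs (\<lambda>\<mu>. next_I D X z \<mu> \<nu>)"
    by (rule set_borel_measurable_subset[OF measurable_next_I_section[OF medium meas z n]])
       (auto simp: dirs_def)
qed (use next_I_bounds[OF z _ n] in auto)

lemma absorbed_nonneg: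
  assumes "z \<in> alts D" "\<nu> \<in> freqs"
  shows "0 \<le> absorbed D (next_I D X) z \<nu>"
proof -
  have "0 \<le> moment (\<lambda>_. 1) (\<lambda>_. 1) (\<lambda>\<mu>. next_I D X z \<mu> \<nu>)"
    using next_I_bounds(1)[OF assms(1) _ assms(2)] by (intro moment_nonneg weight_one)
  then show ?thesis using medium_pos[OF medium assms] by (simp add: absorbed_moment)
qed

lemma absorbed_le:
  assumes "z \<in> alts D" "\<nu> \<in> freqs"
  shows "absorbed D (next_I D X) z \<nu> \<le> absorbed D (next_I D W) z \<nu>"
proof -
  have "moment (\<lambda>_. 1) (\<lambda>_. 1) (\<lambda>\<mu>. next_I D X z \<mu> \<nu>) \<le> moment (\<lambda>_. 1) (\<lambda>_. 1) (\<lambda>\<mu>. next_I D W z \<mu> \<nu>)"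
    using next_I_bounds(2)[OF assms(1) _ assms(2)] next_I_integrable[OF assms]
      iter_definedD(3)[OF defined_W assms] by (intro moment_mono weight_one)
  then show ?thesis using medium_pos[OF medium assms] by (simp add: absorbed_moment)
qed

lemma absorbed_integrable:
  assumes z: "z \<in> alts D"
  shows "set_integrable lborel freqs (absorbed D (next_I D X) z)"
  by (rule set_integrable_dominated[OF iter_definedD(4)[OF defined_W z]
        measurable_absorbed_section[OF medium meas z]])
     (use absorbed_nonneg absorbed_le z in auto)

lemma temperature_dominated:
  assumes z: "z \<in> alts D"
  obtains t where "t \<le> next_T D W z" "is_temp D (next_I D X) z t"
proof -
  have W: "is_temp D (next_I D W) z (next_T D W z)"
    by (rule is_temp_next_T[OF defined_W z])
  have "(LBINT \<nu>:freqs. absorbed D (next_I D X) z \<nu>) \<le> (LBINT \<nu>:freqs. absorbed D (next_I D W) z \<nu>)"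
    by (intro set_integral_mono absorbed_integrable iter_definedD(4)[OF defined_W] absorbed_le z)
  moreover have "0 \<le> (LBINT \<nu>:freqs. absorbed D (next_I D X) z \<nu>)"
    by (intro set_integral_nonneg_vec absorbed_nonneg z)
  ultimately show thesis
    using W temperature_exists[OF medium z, of "next_T D W z" "next_I D X"] that
    by (auto simp: is_temp_def)
qed

lemma defined_X: "iter_defined D X"
  unfolding iter_defined_iff
proof (intro conjI ballI)
  show "angular_integrable D X" by (rule int_X)
  show "beams_conv D X z \<mu> \<nu>" if "z \<in> alts D" "\<mu> \<in> dirs" "\<nu> \<in> freqs" for z \<mu> \<nu>
    using that iter_definedD(2)[OF defined_W that]
    by (intro beams_conv_dominated) (auto simp: dirs_def)
  show "angular_integrable D (iter D X)"
    by (simp add: angular_integrable_def next_I_integrable)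
  fix z assume z: "z \<in> alts D"
  show "set_integrable lborel freqs (absorbed D (next_I D X) z)" by (rule absorbed_integrable[OF z])
  obtain t where "is_temp D (next_I D X) z t" using temperature_dominated[OF z] .
  then show "\<exists>!t. is_temp D (next_I D X) z t"
    using temperature_unique[OF medium z] by blast
qed

lemma admissible_X: "admissible D X"
  by (simp add: admissible_def nonneg meas defined_X)

lemma iter_le: "state_le D (iter D X) (iter D W)"
proof -
  have "next_T D X z \<le> next_T D W z" if z: "z \<in> alts D" for z
  proof -
    obtain t where "t \<le> next_T D W z" "is_temp D (next_I D X) z t"
      using temperature_dominated[OF z] .
    then show ?thesis
      using temperature_unique[OF medium z is_temp_next_T[OF defined_X z]] by simp
  qed
  then show ?thesis by (auto simp: state_le_def next_I_bounds)
qed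

lemma iter_nonneg: "state_le D zero_state (iter D X)"
  using is_temp_next_T[OF defined_X]
  by (auto simp: state_le_def zero_state_def next_I_bounds is_temp_def)

lemma iter_measurable: "measurable_state D (iter D X)"
  by (rule measurable_iter[OF medium meas defined_X])

end

lemma dominated_iterI:
  assumes "medium_ok D" "admissible D W" "measurable_state D X" "state_le D zero_state X" "state_le D X W"
  shows "dominated_iter D X W"
  using assms
  by (simp add: dominated_iter_def dominated_iter_axioms_def dominated_def admissible_def iter_defined_iff)

text \<open>The emitted energies converge. Since total emission is strictly increasing, a temperature staying on
  the wrong side of a barrier \<open>a \<noteq> next_T D L z\<close> would keep the emitted energy on the wrong side of the
  emission at \<open>a\<close>. The bound by the temperature of \<open>W\<close> ensures that the emission at \<open>a\<close> is
  finite whenever it is used.\<close>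

lemma next_T_tendsto:
  assumes D: "medium_ok D" and z: "z \<in> alts D"
    and defd: "\<And>k. iter_defined D (Xs k)" "iter_defined D L" "iter_defined D W"
    and le: "\<And>k. next_T D (Xs k) z \<le> next_T D W z"
    and lim: "(\<lambda>k. LBINT \<nu>:freqs. absorbed D (next_I D (Xs k)) z \<nu>)
      \<longlonglongrightarrow> (LBINT \<nu>:freqs. absorbed D (next_I D L) z \<nu>)"
  shows "(\<lambda>k. next_T D (Xs k) z) \<longlonglongrightarrow> next_T D L z"
proof -
  let ?G = "\<lambda>t. LBINT \<nu>:freqs. emitted D t z \<nu>"
  have T: "0 \<le> next_T D V z" "set_integrable lborel freqs (emitted D (next_T D V z) z)"
    "?G (next_T D V z) = (LBINT \<nu>:freqs. absorbed D (next_I D V) z \<nu>)" if "iter_defined D V" for V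
    using is_temp_next_T[OF that z] by (auto simp: is_temp_def)
  have G: "(\<lambda>k. ?G (next_T D (Xs k) z)) \<longlonglongrightarrow> ?G (next_T D L z)"
    using lim by (simp add: T(3) defd)
  show ?thesis
  proof (rule order_tendstoI)
    fix a assume a: "a < next_T D L z"
    show "\<forall>\<^sub>F k in sequentially. a < next_T D (Xs k) z"
    proof (cases "0 \<le> a")
      case True
      have "?G a < ?G (next_T D L z)"
        by (rule emission_strict_mono[OF D z T(2)[OF defd(2)] True a])
      from order_tendstoD(1)[OF G this] show ?thesis
      proof eventually_elim
        fix k assume g: "?G a < ?G (next_T D (Xs k) z)"
        have i: "set_integrable lborel freqs (emitted D a z)"
          by (rule emitted_integrable_below[OF D z T(2)[OF defd(2)] True]) (use a in simp)
        show "a < next_T D (Xs k) z"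
          using g emission_mono[OF D z i T(1)[OF defd(1)], of k] by (cases "a < next_T D (Xs k) z") auto
      qed
    next
      case False
      then show ?thesis
        using T(1)[OF defd(1)] by (intro always_eventually) (auto intro: less_le_trans simp: not_le)
    qed
  next
    fix a assume a: "next_T D L z < a"
    show "\<forall>\<^sub>F k in sequentially. next_T D (Xs k) z < a"
    proof (cases "a \<le> next_T D W z")
      case True
      have a0: "0 \<le> a" using a T(1)[OF defd(2)] by simp
      have i: "set_integrable lborel freqs (emitted D a z)"
        by (rule emitted_integrable_below[OF D z T(2)[OF defd(3)] a0 True])
      have "?G (next_T D L z) < ?G a"
        by (rule emission_strict_mono[OF D z i T(1)[OF defd(2)] a])
      from order_tendstoD(2)[OF G this] show ?thesis
      proof eventually_elim
        fix k assume "?G (next_T D (Xs k) z) < ?G a"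
        then show "next_T D (Xs k) z < a"
          using emission_mono[OF D z T(2)[OF defd(1)] a0, of k] by (cases "next_T D (Xs k) z < a") auto
      qed
    next
      case False
      then show ?thesis using le by (intro always_eventually) (auto intro: le_less_trans simp: not_le)
    qed
  qed
qed

text \<open>The iteration map is continuous under dominated pointwise convergence.\<close>

lemma iter_tendsto:
  assumes dom: "\<And>k. dominated_iter D (Xs k) W" "dominated_iter D L W" and l: "state_lim D Xs L"
  shows "state_lim D (\<lambda>k. iter D (Xs k)) (iter D L)"
proof -
  interpret L: dominated_iter D L W by fact
  interpret X: dominated_iter D "Xs k" W for k by (rule dom)
  have I: "(\<lambda>k. next_I D (Xs k) z \<mu> \<nu>) \<longlonglongrightarrow> next_I D L z \<mu> \<nu>"
    if "z \<in> alts D" "\<mu> \<in> dirs" "\<nu> \<in> freqs" for z \<mu> \<nu>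
    by (rule next_I_tendsto[OF _ _ l that iter_definedD(2)[OF L.defined_W that]]) unfold_locales
  have "(\<lambda>k. next_T D (Xs k) z) \<longlonglongrightarrow> next_T D L z" if z: "z \<in> alts D" for z
  proof (rule next_T_tendsto[OF L.medium z X.defined_X L.defined_X L.defined_W])
    show "next_T D (Xs k) z \<le> next_T D W z" for k
      using state_leD(1)[OF X.iter_le z] by simp
    have "(\<lambda>k. absorbed D (next_I D (Xs k)) z \<nu>) \<longlonglongrightarrow> absorbed D (next_I D L) z \<nu>"
      if n: "\<nu> \<in> freqs" for \<nu>
      unfolding absorbed_moment
      by (intro tendsto_mult tendsto_const
          moment_tendsto[OF iter_definedD(3)[OF L.defined_W z n] X.next_I_integrable[OF z n]
            L.next_I_integrable[OF z n] X.next_I_bounds(1)[OF z _ n] X.next_I_bounds(2)[OF z _ n]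
            I[OF z _ n] weight_one weight_one])
    then show "(\<lambda>k. LBINT \<nu>:freqs. absorbed D (next_I D (Xs k)) z \<nu>)
        \<longlonglongrightarrow> (LBINT \<nu>:freqs. absorbed D (next_I D L) z \<nu>)"
      by (intro set_integral_tendsto_dominated[OF iter_definedD(4)[OF L.defined_W z]]
          measurable_absorbed_section[OF L.medium _ z] X.meas L.meas X.absorbed_nonneg X.absorbed_le z)
  qed
  then show ?thesis using I by (simp add: state_lim_def)
qed

section \<open>Monotone sequences of iterates\<close>

lemma state_le_refl: "state_le D X X"
  by (simp add: state_le_def)

lemma state_le_trans: "state_le D X V \<Longrightarrow> state_le D V W \<Longrightarrow> state_le D X W"
  by (fastforce simp: state_le_def intro: order_trans)

lemma state_eq_imp_le: "state_eq D X W \<Longrightarrow> state_le D X W" "state_eq D X W \<Longrightarrow> state_le D W X"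
  by (simp_all add: state_eq_def state_le_def)

lemma LIMSEQ_le_vec2:
  fixes f g :: "nat \<Rightarrow> real^2"
  assumes "f \<longlonglongrightarrow> a" "g \<longlonglongrightarrow> b" "\<And>k. f k \<le> g k"
  shows "a \<le> b"
  using assms(3) tendsto_vec_nth[OF assms(1)] tendsto_vec_nth[OF assms(2)]
  unfolding less_eq_vec_def by (blast intro: LIMSEQ_le)

lemma state_lim_le:
  assumes "state_lim D Xs L" "state_lim D Vs M" "\<And>k. state_le D (Xs k) (Vs k)"
  shows "state_le D L M"
  unfolding state_le_def
proof (intro conjI ballI)
  fix z assume z: "z \<in> alts D"
  show "fst L z \<le> fst M z"
    by (rule LIMSEQ_le[OF state_limD(1)[OF assms(1) z] state_limD(1)[OF assms(2) z]])
       (use state_leD(1)[OF assms(3) z] in blast)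
  show "snd L z \<mu> \<nu> \<le> snd M z \<mu> \<nu>" if "\<mu> \<in> dirs" "\<nu> \<in> freqs" for \<mu> \<nu>
    by (rule LIMSEQ_le_vec2[OF state_limD(2)[OF assms(1) z that] state_limD(2)[OF assms(2) z that]
          state_leD(2)[OF assms(3) z that]])
qed

lemma state_lim_const: "state_lim D (\<lambda>_. X) X"
  by (simp add: state_lim_def)

lemma state_lim_unique:
  assumes "state_lim D Xs L" "state_lim D Xs M"
  shows "state_eq D L M"
  using state_lim_le[OF assms state_le_refl] state_lim_le[OF assms(2,1) state_le_refl]
  by (simp add: state_eq_def state_le_def order_antisym)

lemma state_lim_eq: "state_lim D Xs L \<Longrightarrow> state_eq D L M \<Longrightarrow> state_lim D Xs M"
  by (simp add: state_lim_def state_eq_def)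

lemma state_lim_measurable:
  assumes "\<And>k. measurable_state D (Xs k)" "state_lim D Xs L"
  shows "measurable_state D L"
  unfolding measurable_state_def
proof
  show "fst L \<in> borel_measurable (restrict_space borel (alts D))"
    by (rule borel_measurable_LIMSEQ_metric[where f="\<lambda>k. fst (Xs k)"])
       (use assms in \<open>auto simp: measurable_state_def space_restrict_space state_lim_def\<close>)
  show "(\<lambda>(z, \<mu>, \<nu>). snd L z \<mu> \<nu>) \<in> borel_measurable (restrict_space borel (alts D \<times> dirs \<times> freqs))"
    by (rule borel_measurable_LIMSEQ_metric[where f="\<lambda>k (z, \<mu>, \<nu>). snd (Xs k) z \<mu> \<nu>"])
       (use assms in \<open>auto simp: measurable_state_def space_restrict_space state_lim_def\<close>)
qed

lemma monotone_bounded_LIMSEQ: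
  fixes a :: "nat \<Rightarrow> real"
  assumes "(\<forall>k. a k \<le> a (Suc k)) \<or> (\<forall>k. a (Suc k) \<le> a k)" "\<And>k. 0 \<le> a k" "\<And>k. a k \<le> b"
  shows "a \<longlonglongrightarrow> lim a"
proof -
  have "Bseq a" using assms(2,3) by (intro BseqI'[of _ b]) simp
  moreover have "monoseq a"
    using assms(1) by (auto simp: monoseq_Suc)
  ultimately show ?thesis
    using Bseq_monoseq_convergent convergent_LIMSEQ_iff by blast
qed

lemma monotone_bounded_state_lim:
  assumes mono: "(\<forall>k. state_le D (Xs k) (Xs (Suc k))) \<or> (\<forall>k. state_le D (Xs (Suc k)) (Xs k))"
    and b: "\<And>k. state_le D zero_state (Xs k)" "\<And>k. state_le D (Xs k) W"
  obtains L where "state_lim D Xs L"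
proof
  show "state_lim D Xs (\<lambda>z. lim (\<lambda>k. fst (Xs k) z),
      \<lambda>z \<mu> \<nu>. vector [lim (\<lambda>k. snd (Xs k) z \<mu> \<nu> $ 1), lim (\<lambda>k. snd (Xs k) z \<mu> \<nu> $ 2)])"
    unfolding state_lim_def fst_conv snd_conv
  proof (intro conjI ballI)
    fix z assume z: "z \<in> alts D"
    show "(\<lambda>k. fst (Xs k) z) \<longlonglongrightarrow> lim (\<lambda>k. fst (Xs k) z)"
      by (rule monotone_bounded_LIMSEQ[where b="fst W z"])
         (use mono z state_nonnegD(1)[OF b(1) z] state_leD(1)[OF b(2) z] in \<open>auto simp: state_le_def\<close>)
    fix \<mu> \<nu> assume m: "\<mu> \<in> dirs" and n: "\<nu> \<in> freqs"
    have c: "(\<lambda>k. snd (Xs k) z \<mu> \<nu> $ i) \<longlonglongrightarrow> lim (\<lambda>k. snd (Xs k) z \<mu> \<nu> $ i)" for i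
      by (rule monotone_bounded_LIMSEQ[where b="snd W z \<mu> \<nu> $ i"])
         (use mono z m n state_nonnegD(2)[OF b(1) z m n] state_leD(2)[OF b(2) z m n] in
           \<open>auto simp: state_le_def less_eq_vec_def\<close>)
    have "(\<lambda>k. vector [snd (Xs k) z \<mu> \<nu> $ 1, snd (Xs k) z \<mu> \<nu> $ 2] :: real^2)
        \<longlonglongrightarrow> vector [lim (\<lambda>k. snd (Xs k) z \<mu> \<nu> $ 1), lim (\<lambda>k. snd (Xs k) z \<mu> \<nu> $ 2)]"
      by (rule tendsto_vec2I[OF c c])
    moreover have "vector [v $ 1, v $ 2] = v" for v :: "real^2"
      by (simp add: vec_eq_iff forall_2)
    ultimately show "(\<lambda>k. snd (Xs k) z \<mu> \<nu>)
        \<longlonglongrightarrow> vector [lim (\<lambda>k. snd (Xs k) z \<mu> \<nu> $ 1), lim (\<lambda>k. snd (Xs k) z \<mu> \<nu> $ 2)]"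
      by simp
  qed
qed

lemma iterates_Suc [simp]: "iterates D X (Suc k) = iter D (iterates D X k)"
  by (simp add: iterates_def)

lemma iterates_0 [simp]: "iterates D X 0 = X"
  by (simp add: iterates_def)

text \<open>A bounded monotone sequence of iterates converges pointwise, and by continuity of the iteration map
  its limit is a fixed point. That the map is defined at the limit follows from domination by \<open>W\<close>.\<close>

lemma monotone_iterates_converge:
  assumes D: "medium_ok D" and W: "admissible D W" and adm: "\<And>k. admissible D (iterates D X k)"
    and mono: "(\<forall>k. state_le D (iterates D X k) (iterates D X (Suc k))) \<or>
      (\<forall>k. state_le D (iterates D X (Suc k)) (iterates D X k))"
    and below: "\<And>k. state_le D (iterates D X k) W"
  obtains L where "solution D L" "state_lim D (iterates D X) L"
proof -
  have nonneg: "state_le D zero_state (iterates D X k)" for k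
    using adm by (simp add: admissible_def)
  obtain L where l: "state_lim D (iterates D X) L"
    using monotone_bounded_state_lim[OF mono nonneg below] .
  have dX: "dominated_iter D (iterates D X k) W" for k
    using adm by (intro dominated_iterI[OF D W] below) (simp_all add: admissible_def)
  have dL: "dominated_iter D L W"
  proof (rule dominated_iterI[OF D W])
    show "measurable_state D L"
      using adm by (intro state_lim_measurable[OF _ l]) (simp add: admissible_def)
  qed (rule state_lim_le[OF state_lim_const l nonneg] state_lim_le[OF l state_lim_const below])+
  have "state_lim D (\<lambda>k. iterates D X (Suc k)) (iter D L)"
    using iter_tendsto[OF dX dL l] by simp
  moreover have "state_lim D (\<lambda>k. iterates D X (Suc k)) L"
    using l unfolding state_lim_def by (auto intro: LIMSEQ_Suc simp del: iterates_Suc)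
  ultimately have "state_eq D (iter D L) L" by (rule state_lim_unique)
  then have "solution D L"
    using dominated_iter.admissible_X[OF dL] by (simp add: solution_def)
  then show thesis using l that by blast
qed

text \<open>Each iterate dominates the next one, which therefore is admissible.\<close>

lemma decreasing_iterates:
  assumes D: "medium_ok D" and X0: "decreasing_start D X0"
  shows "admissible D (iterates D X0 k)" "state_le D (iterates D X0 (Suc k)) (iterates D X0 k)"
    "state_le D (iterates D X0 k) X0"
proof -
  have "admissible D (iterates D X0 k) \<and> state_le D (iterates D X0 (Suc k)) (iterates D X0 k)
      \<and> state_le D (iterates D X0 k) X0"
  proof (induction k)
    case 0
    then show ?case using X0 by (simp add: decreasing_start_def state_le_refl)
  next
    case (Suc k)
    let ?X = "iterates D X0 k"
    have X: "admissible D ?X" "state_le D (iter D ?X) ?X" using Suc by simp_all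
    interpret S: dominated_iter D ?X ?X
      using X(1) by (intro dominated_iterI[OF D X(1)] state_le_refl) (simp_all add: admissible_def)
    interpret N: dominated_iter D "iter D ?X" ?X
      by (intro dominated_iterI[OF D X(1)] S.iter_measurable S.iter_nonneg X(2))
    show ?case
      using N.admissible_X N.iter_le Suc state_le_trans[OF X(2)] by simp
  qed
  then show "admissible D (iterates D X0 k)" "state_le D (iterates D X0 (Suc k)) (iterates D X0 k)"
    "state_le D (iterates D X0 k) X0" by simp_all
qed

text \<open>Iterates from zero stay below the solution \<open>X\<close>, since \<open>X\<close> is its own update; hence all of them
  are admissible, dominated by \<open>X\<close>.\<close>

lemma increasing_iterates:
  assumes D: "medium_ok D" and X: "solution D X"
  shows "admissible D (iterates D zero_state k)"
    "state_le D (iterates D zero_state k) (iterates D zero_state (Suc k))"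
    "state_le D (iterates D zero_state k) X"
proof -
  have adm: "admissible D X" and eq: "state_le D (iter D X) X"
    using X state_eq_imp_le by (auto simp: solution_def)
  have "admissible D (iterates D zero_state k) \<and>
      state_le D (iterates D zero_state k) (iterates D zero_state (Suc k)) \<and>
      state_le D (iterates D zero_state k) X"
  proof (induction k)
    case 0
    interpret Z: dominated_iter D zero_state X
      using adm by (intro dominated_iterI[OF D] measurable_zero_state state_le_refl)
        (simp_all add: admissible_def)
    show ?case using adm Z.admissible_X Z.iter_nonneg by (simp add: admissible_def)
  next
    case (Suc k)
    let ?V = "iterates D zero_state k"
    have V: "admissible D ?V" "state_le D ?V (iter D ?V)" "state_le D ?V X" using Suc by simp_all
    interpret V: dominated_iter D ?V X
      using V by (intro dominated_iterI[OF D adm]) (simp_all add: admissible_def)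
    have le: "state_le D (iter D ?V) X" by (rule state_le_trans[OF V.iter_le eq])
    interpret N: dominated_iter D "iter D ?V" X
      by (intro dominated_iterI[OF D adm] V.iter_measurable V.iter_nonneg le)
    interpret S: dominated_iter D ?V "iter D ?V"
      by (intro dominated_iterI[OF D N.admissible_X] V.meas V.nonneg V(2))
    show ?case using N.admissible_X S.iter_le le by simp
  qed
  then show "admissible D (iterates D zero_state k)"
    "state_le D (iterates D zero_state k) (iterates D zero_state (Suc k))"
    "state_le D (iterates D zero_state k) X" by simp_all
qed

lemma solution_below_iterates:
  assumes D: "medium_ok D" and X: "solution D X" and X0: "decreasing_start D X0" and le: "state_le D X X0"
  shows "state_le D X (iterates D X0 k)"
proof (induction k)
  case 0
  then show ?case using le by simp
next
  case (Suc k)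
  interpret dominated_iter D X "iterates D X0 k"
    using X decreasing_iterates(1)[OF D X0] Suc
    by (intro dominated_iterI[OF D]) (simp_all add: solution_def admissible_def)
  have "state_le D X (iter D X)" using X state_eq_imp_le by (auto simp: solution_def)
  then show ?case using state_le_trans iter_le by simp
qed

theorem proposition1:
  fixes D :: medium
  assumes "medium_ok D"
  shows
    "(\<forall>X. solution D X \<longrightarrow>
        (\<forall>m. admissible D (iterates D zero_state m)) \<and>
        (\<forall>m. state_le D (iterates D zero_state m) (iterates D zero_state (Suc m))) \<and>
        (\<exists>L. solution D L \<and> state_le D L X \<and> state_lim D (iterates D zero_state) L) \<and>
        (\<forall>X0. decreasing_start D X0 \<longrightarrow>
           (\<forall>m. admissible D (iterates D X0 m)) \<and>
           (\<forall>m. state_le D (iterates D X0 (Suc m)) (iterates D X0 m)) \<and>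
           (\<exists>L. solution D L \<and> (state_le D X X0 \<longrightarrow> state_le D X L) \<and>
                state_lim D (iterates D X0) L)) \<and>
        ((\<forall>X'. solution D X' \<longrightarrow> state_eq D X' X) \<longrightarrow>
           state_lim D (iterates D zero_state) X \<and>
           (\<forall>X0. decreasing_start D X0 \<longrightarrow> state_lim D (iterates D X0) X)))
     \<and>
     (\<forall>X0. decreasing_start D X0 \<longrightarrow>
        (\<forall>m. admissible D (iterates D X0 m)) \<and>
        (\<exists>X. solution D X \<and> state_lim D (iterates D X0) X))"
proof -
  note D = assms
  have up: "\<exists>L. solution D L \<and> state_le D L X \<and> state_lim D (iterates D zero_state) L"
    if X: "solution D X" for X
  proof -
    note inc = increasing_iterates[OF D X]
    obtain L where L: "solution D L" "state_lim D (iterates D zero_state) L"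
      using monotone_iterates_converge[OF D _ inc(1) _ inc(3)] X inc(2) by (auto simp: solution_def)
    then show ?thesis using state_lim_le[OF L(2) state_lim_const inc(3)] by blast
  qed
  have down: "\<exists>L. solution D L \<and> (\<forall>X. solution D X \<longrightarrow> state_le D X X0 \<longrightarrow> state_le D X L) \<and>
      state_lim D (iterates D X0) L" if X0: "decreasing_start D X0" for X0
  proof -
    note dec = decreasing_iterates[OF D X0]
    obtain L where L: "solution D L" "state_lim D (iterates D X0) L"
      using monotone_iterates_converge[OF D _ dec(1) _ dec(3)] X0 dec(2)
      by (auto simp: decreasing_start_def)
    then show ?thesis
      using state_lim_le[OF state_lim_const L(2) solution_below_iterates[OF D _ X0]] by blast
  qed
  show ?thesis
  proof (rule conjI)
    show "\<forall>X0. decreasing_start D X0 \<longrightarrow>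
        (\<forall>m. admissible D (iterates D X0 m)) \<and> (\<exists>X. solution D X \<and> state_lim D (iterates D X0) X)"
      using decreasing_iterates(1)[OF D] down by blast
  next
    show "\<forall>X. solution D X \<longrightarrow>
        (\<forall>m. admissible D (iterates D zero_state m)) \<and>
        (\<forall>m. state_le D (iterates D zero_state m) (iterates D zero_state (Suc m))) \<and>
        (\<exists>L. solution D L \<and> state_le D L X \<and> state_lim D (iterates D zero_state) L) \<and>
        (\<forall>X0. decreasing_start D X0 \<longrightarrow>
           (\<forall>m. admissible D (iterates D X0 m)) \<and>
           (\<forall>m. state_le D (iterates D X0 (Suc m)) (iterates D X0 m)) \<and>
           (\<exists>L. solution D L \<and> (state_le D X X0 \<longrightarrow> state_le D X L) \<and>
                state_lim D (iterates D X0) L)) \<and>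
        ((\<forall>X'. solution D X' \<longrightarrow> state_eq D X' X) \<longrightarrow>
           state_lim D (iterates D zero_state) X \<and>
           (\<forall>X0. decreasing_start D X0 \<longrightarrow> state_lim D (iterates D X0) X))"
    proof (intro allI impI, intro conjI)
      fix X assume X: "solution D X"
      show "\<forall>m. admissible D (iterates D zero_state m)"
        "\<forall>m. state_le D (iterates D zero_state m) (iterates D zero_state (Suc m))"
        using increasing_iterates(1,2)[OF D X] by blast+
      show "\<exists>L. solution D L \<and> state_le D L X \<and> state_lim D (iterates D zero_state) L"
        by (rule up[OF X])
      show "\<forall>X0. decreasing_start D X0 \<longrightarrow>
           (\<forall>m. admissible D (iterates D X0 m)) \<and>
           (\<forall>m. state_le D (iterates D X0 (Suc m)) (iterates D X0 m)) \<and>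
           (\<exists>L. solution D L \<and> (state_le D X X0 \<longrightarrow> state_le D X L) \<and> state_lim D (iterates D X0) L)"
        using decreasing_iterates(1,2)[OF D] down X by blast
      show "(\<forall>X'. solution D X' \<longrightarrow> state_eq D X' X) \<longrightarrow>
           state_lim D (iterates D zero_state) X \<and>
           (\<forall>X0. decreasing_start D X0 \<longrightarrow> state_lim D (iterates D X0) X)"
        using up[OF X] down state_lim_eq by blast
    qed
  qed
qed

end
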